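(* Let $K$ be a field, $S=K[x_1,\dots,x_n]$, let $G$ be a finite simple graph on the vertex set $[n]=\{1,\dots,n\}$, and suppose that its edge ideal $I=I(G)\subset S$ is matroidal. Then, for every $i\ge1$, $$\mathrm{HS}_i(I^{k+1})=I\cdot\mathrm{HS}_i(I^k)\quad\text{for all }k\ge i.$$
   Context: $S$ carries its standard $\mathbb{Z}^n$-grading. For a monomial ideal $J$, $\mathcal{G}(J)$ denotes its minimal set of monomial generators, and $\deg_{x_i}(u)$ is the exponent of $x_i$ in the monomial $u$. For $i\ge0$, $\mathrm{HS}_i(J)=(\mathbf{x}^{\mathbf a}:\ \mathrm{Tor}_i^S(K,J)_{\mathbf a}\neq0)$, where $\mathbf{x}^{\mathbf a}=x_1^{a_1}\cdots x_n^{a_n}$ (the zero ideal if $\mathrm{Tor}_i^S(K,J)=0$). The edge ideal of $G$ is $I(G)=(x_ix_j:\ \{i,j\}\in E(G))$. A nonzero monomial ideal $I$ is polymatroidal if all elements of $\mathcal{G}(I)$ have the same degree and: for all $u,v\in\mathcal{G}(I)$ and all $i$ with $\deg_{x_i}(u)>\deg_{x_i}(v)$, there is $j$ with $\deg_{x_j}(u)<\deg_{x_j}(v)$ such that $x_j(u/x_i)\in\mathcal{G}(I)$. A squarefree polymatroidal ideal is called matroidal. *)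

theory Defs
  imports "HOL-Library.Poly_Mapping" "Jordan_Normal_Form.Matrix"
begin

section \<open>Monomial ideals\<close>

text \<open>The polynomial ring \<open>S\<close> over \<open>'k\<close> is the monoid algebra of the exponent monoid
  \<open>'n \<Rightarrow>\<^sub>0 nat\<close>; its variables are indexed by the elements of the finite type \<open>'n\<close>,
  which plays the role of \<open>{1,\<dots>,n}\<close>.\<close>

type_synonym ('n, 'k) polyring = "('n \<Rightarrow>\<^sub>0 nat) \<Rightarrow>\<^sub>0 'k"

text \<open>Ideals of a commutative ring are the submodules of the ring over itself.\<close>

global_interpretation ideal: Modules.module "(*) :: 'a::comm_ring_1 \<Rightarrow> 'a \<Rightarrow> 'a"
  by standard (simp_all add: algebra_simps)

definition ideal_prod :: "'a::comm_ring_1 set \<Rightarrow> 'a set \<Rightarrow> 'a set" where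
  "ideal_prod I J = ideal.span {f * g | f g. f \<in> I \<and> g \<in> J}"

primrec ideal_pow :: "'a::comm_ring_1 set \<Rightarrow> nat \<Rightarrow> 'a set" where
  "ideal_pow I 0 = UNIV"
| "ideal_pow I (Suc k) = ideal_prod I (ideal_pow I k)"

definition monomial :: "('n \<Rightarrow>\<^sub>0 nat) \<Rightarrow> ('n, 'k::comm_ring_1) polyring" where
  "monomial a = Poly_Mapping.single a 1"

definition Var :: "'n \<Rightarrow> ('n, 'k::comm_ring_1) polyring" where
  "Var i = monomial (Poly_Mapping.single i 1)"

definition monomial_ideal :: "('n, 'k::comm_ring_1) polyring set \<Rightarrow> bool" where
  "monomial_ideal J \<longleftrightarrow> (\<exists>A. J = ideal.span (monomial ` A))"

text \<open>Monomials are represented by their exponents. A monomial ideal has exactly one minimal set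
  of monomial generators; the value on other ideals is irrelevant.\<close>

definition min_gens :: "('n, 'k::comm_ring_1) polyring set \<Rightarrow> ('n \<Rightarrow>\<^sub>0 nat) set" where
  "min_gens J = (THE A. ideal.span (monomial ` A) = J \<and>
                        (\<forall>B. B \<subset> A \<longrightarrow> ideal.span (monomial ` B) \<noteq> J))"

definition polymatroidal :: "('n::finite, 'k::comm_ring_1) polyring set \<Rightarrow> bool" where
  "polymatroidal J \<longleftrightarrow>
     monomial_ideal J \<and> J \<noteq> {0} \<and>
     (\<forall>u\<in>min_gens J. \<forall>v\<in>min_gens J.
        (\<Sum>i\<in>UNIV. Poly_Mapping.lookup u i) = (\<Sum>i\<in>UNIV. Poly_Mapping.lookup v i)) \<and>
     (\<forall>u\<in>min_gens J. \<forall>v\<in>min_gens J. \<forall>i. Poly_Mapping.lookup u i > Poly_Mapping.lookup v i \<longrightarrow>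
        (\<exists>j. Poly_Mapping.lookup u j < Poly_Mapping.lookup v j \<and>
             Poly_Mapping.single j 1 + (u - Poly_Mapping.single i 1) \<in> min_gens J))"

definition matroidal :: "('n::finite, 'k::comm_ring_1) polyring set \<Rightarrow> bool" where
  "matroidal J \<longleftrightarrow> polymatroidal J \<and> (\<forall>u\<in>min_gens J. \<forall>i. Poly_Mapping.lookup u i \<le> 1)"

definition edge_ideal :: "'n set set \<Rightarrow> ('n, 'k::comm_ring_1) polyring set" where
  "edge_ideal E = ideal.span {Var i * Var j | i j. {i, j} \<in> E}"


section \<open>Multigraded Tor\<close>

definition homogeneous :: "('n \<Rightarrow> int) \<Rightarrow> ('n, 'k::comm_ring_1) polyring \<Rightarrow> bool" where
  "homogeneous a f \<longleftrightarrow> (\<forall>m\<in>Poly_Mapping.keys f. \<forall>i. int (Poly_Mapping.lookup m i) = a i)"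

text \<open>A complex \<open>\<dots> \<rightarrow> F\<^sub>1 \<rightarrow> F\<^sub>0 \<rightarrow> 0\<close> of finitely generated free \<open>S\<close>-modules: \<open>F\<^sub>i\<close> has a basis
  \<open>e\<^sub>0, \<dots>, e\<^sub>r\<^sub>-\<^sub>1\<close> with \<open>r = rk F i\<close>, where \<open>e\<^sub>j\<close> has multidegree \<open>mdeg F i j\<close>, and
  \<open>bd F i\<close> is the matrix of \<open>F\<^sub>i \<rightarrow> F\<^sub>i\<^sub>-\<^sub>1\<close> (with no rows if \<open>i = 0\<close>).\<close>

record (overloaded) ('n, 'k) free_complex =
  rk :: "nat \<Rightarrow> nat"
  mdeg :: "nat \<Rightarrow> nat \<Rightarrow> 'n \<Rightarrow> int"
  bd :: "nat \<Rightarrow> ('n, 'k) polyring mat"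

definition graded_free_complex :: "('n, 'k::comm_ring_1) free_complex \<Rightarrow> bool" where
  "graded_free_complex F \<longleftrightarrow>
     bd F 0 \<in> carrier_mat 0 (rk F 0) \<and>
     (\<forall>i. bd F (Suc i) \<in> carrier_mat (rk F i) (rk F (Suc i)) \<and>
          (\<forall>l<rk F i. \<forall>j<rk F (Suc i).
             homogeneous (\<lambda>s. mdeg F (Suc i) j s - mdeg F i l s) (bd F (Suc i) $$ (l, j))) \<and>
          bd F i * bd F (Suc i) = 0\<^sub>m (dim_row (bd F i)) (rk F (Suc i)))"

text \<open>\<open>F\<close> is a multigraded free resolution of \<open>K = S/(x\<^sub>1,\<dots>,x\<^sub>n)\<close>, which is concentrated in
  multidegree 0 and on which a polynomial acts through its constant term; the augmentation
  \<open>F\<^sub>0 \<rightarrow> K\<close> sends \<open>e\<^sub>j\<close> to \<open>\<epsilon> j\<close>.\<close>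

definition resolves_residue_field :: "('n, 'k::field) free_complex \<Rightarrow> bool" where
  "resolves_residue_field F \<longleftrightarrow>
     graded_free_complex F \<and>
     (\<exists>\<epsilon> :: nat \<Rightarrow> 'k.
        (\<forall>j<rk F 0. \<epsilon> j \<noteq> 0 \<longrightarrow> mdeg F 0 j = (\<lambda>s. 0)) \<and>
        (\<exists>j<rk F 0. \<epsilon> j \<noteq> 0) \<and>
        {v \<in> carrier_vec (rk F 0). (\<Sum>j<rk F 0. Poly_Mapping.lookup (v $ j) 0 * \<epsilon> j) = 0}
          = (\<lambda>w. bd F 1 *\<^sub>v w) ` carrier_vec (rk F 1)) \<and>
     (\<forall>i\<ge>1. {v \<in> carrier_vec (rk F i). bd F i *\<^sub>v v = 0\<^sub>v (dim_row (bd F i))}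
              = (\<lambda>w. bd F (Suc i) *\<^sub>v w) ` carrier_vec (rk F (Suc i)))"

text \<open>Since \<open>F\<^sub>i\<close> is free, \<open>F\<^sub>i \<otimes>\<^sub>S J\<close> is the module of vectors over \<open>F\<^sub>i\<close>'s basis with entries in
  \<open>J\<close>, with differential given by the same matrices. The sets below are the component of
  multidegree \<open>a\<close> of \<open>F\<^sub>i \<otimes> J\<close> and of its cycles and boundaries.\<close>

definition tensor_chains ::
  "('n, 'k::comm_ring_1) free_complex \<Rightarrow> ('n, 'k) polyring set \<Rightarrow> nat \<Rightarrow> ('n \<Rightarrow> int)
     \<Rightarrow> ('n, 'k) polyring vec set" where
  "tensor_chains F J i a =
     {v \<in> carrier_vec (rk F i).
        \<forall>j<rk F i. v $ j \<in> J \<and> homogeneous (\<lambda>s. a s - mdeg F i j s) (v $ j)}"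

definition tensor_cycles ::
  "('n, 'k::comm_ring_1) free_complex \<Rightarrow> ('n, 'k) polyring set \<Rightarrow> nat \<Rightarrow> ('n \<Rightarrow> int)
     \<Rightarrow> ('n, 'k) polyring vec set" where
  "tensor_cycles F J i a =
     {v \<in> tensor_chains F J i a. bd F i *\<^sub>v v = 0\<^sub>v (dim_row (bd F i))}"

definition tensor_boundaries ::
  "('n, 'k::comm_ring_1) free_complex \<Rightarrow> ('n, 'k) polyring set \<Rightarrow> nat \<Rightarrow> ('n \<Rightarrow> int)
     \<Rightarrow> ('n, 'k) polyring vec set" where
  "tensor_boundaries F J i a = (\<lambda>w. bd F (Suc i) *\<^sub>v w) ` tensor_chains F J (Suc i) a"

text \<open>\<open>Tor\<^sub>i(K, J)\<^sub>a\<close> is cycles modulo boundaries. As it does not depend on the resolution of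
  \<open>K\<close> up to isomorphism, and resolutions of the above kind exist (the Koszul complex), it is
  nonzero iff it is so for some resolution.\<close>

definition Tor_nonzero :: "nat \<Rightarrow> ('n, 'k::field) polyring set \<Rightarrow> ('n \<Rightarrow> int) \<Rightarrow> bool" where
  "Tor_nonzero i J a \<longleftrightarrow>
     (\<exists>F. resolves_residue_field F \<and> tensor_cycles F J i a \<noteq> tensor_boundaries F J i a)"

definition HS :: "nat \<Rightarrow> ('n, 'k::field) polyring set \<Rightarrow> ('n, 'k) polyring set" where
  "HS i J = ideal.span {monomial a | a. Tor_nonzero i J (\<lambda>s. int (Poly_Mapping.lookup a s))}"

end

theory Submission
  imports Defs
begin

text \<open>A graph whose edge ideal is matroidal is complete multipartite up to isolated vertices, so the
  generators of \<open>I\<^sup>k\<close> are the monomials of degree \<open>2k\<close> in its vertices of degree at most \<open>k\<close>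
  in every part. In lexicographic order they have linear quotients. Adding them one at a time, the
  long exact \<open>Tor\<close> sequences split for degree reasons, and \<open>HS\<^sub>i(I\<^sup>k)\<close> is generated by the
  \<open>u x\<^sub>T\<close> with \<open>T\<close> an \<open>i\<close>-subset of the variables generating the colon ideal at \<open>u\<close>. These
  monomials are characterised by inequalities between the degrees in the parts and the sizes of the
  supports, and from a monomial satisfying the inequalities for \<open>k + 1\<close> an edge can be split off
  such that the rest satisfies those for \<open>k\<close>: since \<open>i \<le> k\<close>, at most two parts have the
  extremal degree.\<close>

section \<open>Homology of finite complexes\<close>

text \<open>The generators \<open>u x_T\<close> depend on the chosen vertex order, and removing an
  edge from \<open>u\<close> changes the variables that \<open>T\<close> may use. The inequalities
  in \<open>shift_gens\<close> mention no order, so an edge can be removed from the monomial itself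
  without keeping track of \<open>u\<close> and \<open>T\<close>. The sequences split because all
  generators have degree \<open>2k\<close>: the classes in homological degree \<open>i\<close> have
  total degree \<open>2k + i\<close>, whereas a connecting map would relate neighbouring homological
  degrees in one and the same multidegree. All \<open>Tor\<close> computations take place in an
  arbitrary resolution \<open>F\<close> of \<open>K\<close>. The only input is that \<open>F\<close>
  is exact; this gives \<open>Tor(K, S)\<close>, then \<open>Tor\<close> of \<open>K\<close> with
  quotients of \<open>S\<close> by variables, one variable at a time, and these quotients are the
  successive quotients of the filtration by linear quotients.\<close>

definition homology_nonzero ::
  "(nat \<Rightarrow> nat \<Rightarrow> nat \<Rightarrow> 'k::field) \<Rightarrow> (nat \<Rightarrow> nat set) \<Rightarrow> nat \<Rightarrow> bool" where
  "homology_nonzero m X i \<longleftrightarrow>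
     (\<exists>c. (\<forall>p. i = Suc p \<longrightarrow> (\<forall>l\<in>X p. (\<Sum>j\<in>X (Suc p). m p l j * c j) = 0)) \<and>
          (\<forall>e. \<exists>l\<in>X i. c l \<noteq> (\<Sum>j\<in>X (Suc i). m i l j * e j)))"

lemma homology_nonzeroE:
  assumes "homology_nonzero m X i"
  obtains c where "\<And>p l. i = Suc p \<Longrightarrow> l \<in> X p \<Longrightarrow> (\<Sum>j\<in>X (Suc p). m p l j * c j) = 0"
    and "\<And>e. \<exists>l\<in>X i. c l \<noteq> (\<Sum>j\<in>X (Suc i). m i l j * e j)"
proof -
  from assms obtain c
    where "\<forall>p. i = Suc p \<longrightarrow> (\<forall>l\<in>X p. (\<Sum>j\<in>X (Suc p). m p l j * c j) = 0)"
      and "\<forall>e. \<exists>l\<in>X i. c l \<noteq> (\<Sum>j\<in>X (Suc i). m i l j * e j)"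
    unfolding homology_nonzero_def by (elim exE conjE)
  then show thesis by (intro that[of c]) simp_all
qed

lemma not_homology_nonzeroE:
  assumes "\<not> homology_nonzero m X i"
    and "\<And>p l. i = Suc p \<Longrightarrow> l \<in> X p \<Longrightarrow> (\<Sum>j\<in>X (Suc p). m p l j * c j) = 0"
  obtains e where "\<And>l. l \<in> X i \<Longrightarrow> c l = (\<Sum>j\<in>X (Suc i). m i l j * e j)"
proof -
  have "\<exists>e. \<forall>l\<in>X i. c l = (\<Sum>j\<in>X (Suc i). m i l j * e j)"
  proof (rule ccontr)
    assume "\<not> ?thesis"
    then have "homology_nonzero m X i"
      unfolding homology_nonzero_def using assms(2) by (intro exI[of _ c] conjI) simp_all
    then show False using assms(1) by simp
  qed
  then show thesis using that by auto
qed

text \<open>\<open>X1\<close> spans a subcomplex and \<open>X2\<close> indexes a basis of the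
  quotient. The long homology sequence is kept only in weak form: a nonzero group forces one of its
  neighbours to be nonzero.\<close>

locale subcomplex =
  fixes m :: "nat \<Rightarrow> nat \<Rightarrow> nat \<Rightarrow> 'k::field" and X X1 X2 :: "nat \<Rightarrow> nat set"
  assumes fin: "\<And>i. finite (X i)"
    and un: "\<And>i. X i = X1 i \<union> X2 i"
    and disj: "\<And>i. X1 i \<inter> X2 i = {}"
    and sq: "\<And>p h j. h \<in> X p \<Longrightarrow> j \<in> X (Suc (Suc p)) \<Longrightarrow>
               (\<Sum>l\<in>X (Suc p). m p h l * m (Suc p) l j) = 0"
    and sub: "\<And>p l j. l \<in> X2 p \<Longrightarrow> j \<in> X1 (Suc p) \<Longrightarrow> m p l j = 0"
begin

lemma fin1: "finite (X1 i)" and fin2: "finite (X2 i)"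
  using fin[of i] un[of i] by auto

lemma sum_X: "(\<Sum>j\<in>X i. f j) = (\<Sum>j\<in>X1 i. f j) + (\<Sum>j\<in>X2 i. f j)"
  unfolding un using fin1 fin2 disj by (simp add: sum.union_disjoint)

lemma sum_X2: "l \<in> X2 p \<Longrightarrow> (\<Sum>j\<in>X (Suc p). m p l j * c j) = (\<Sum>j\<in>X2 (Suc p). m p l j * c j)"
  by (simp add: sum_X sub)

lemma sum_square:
  assumes "h \<in> X p"
  shows "(\<Sum>l\<in>X (Suc p). m p h l * (\<Sum>j\<in>X (Suc (Suc p)). m (Suc p) l j * e j)) = 0"
proof -
  have "(\<Sum>l\<in>X (Suc p). m p h l * (\<Sum>j\<in>X (Suc (Suc p)). m (Suc p) l j * e j))
      = (\<Sum>j\<in>X (Suc (Suc p)). (\<Sum>l\<in>X (Suc p). m p h l * m (Suc p) l j) * e j)"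
    unfolding sum_distrib_left sum_distrib_right
    by (subst sum.swap, intro sum.cong refl) (rule mult.assoc[symmetric])
  also have "\<dots> = 0" using assms by (intro sum.neutral ballI) (simp only: sq mult_zero_left)
  finally show ?thesis .
qed

text \<open>If both outer groups vanish, subtract from a cycle the boundary of a lift
  \<open>e2'\<close> that cancels its \<open>X2\<close> part; the rest is a cycle of the subcomplex
  and bounds there.\<close>

lemma exact_middle:
  assumes "homology_nonzero m X i"
  shows "homology_nonzero m X1 i \<or> homology_nonzero m X2 i"
proof (rule ccontr)
  assume neg: "\<not> ?thesis"
  obtain c where cyc: "\<And>p l. i = Suc p \<Longrightarrow> l \<in> X p \<Longrightarrow> (\<Sum>j\<in>X (Suc p). m p l j * c j) = 0"
    and nb: "\<And>e. \<exists>l\<in>X i. c l \<noteq> (\<Sum>j\<in>X (Suc i). m i l j * e j)"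
    using homology_nonzeroE[OF assms] by blast
  have "(\<Sum>j\<in>X2 (Suc p). m p l j * c j) = 0" if "i = Suc p" "l \<in> X2 p" for p l
    using cyc[OF that(1), of l] sum_X2[OF that(2), of c] that(2) by (simp add: un)
  then obtain e2 where e2: "\<And>l. l \<in> X2 i \<Longrightarrow> c l = (\<Sum>j\<in>X2 (Suc i). m i l j * e2 j)"
    using not_homology_nonzeroE[of m X2 i c] neg by blast
  define e2' where "e2' j = (if j \<in> X2 (Suc i) then e2 j else 0)" for j
  define c' where "c' l = c l - (\<Sum>j\<in>X (Suc i). m i l j * e2' j)" for l
  have sum_e2': "(\<Sum>j\<in>X (Suc i). m i l j * e2' j) = (\<Sum>j\<in>X2 (Suc i). m i l j * e2 j)" for l
  proof -
    have "(\<Sum>j\<in>X1 (Suc i). m i l j * e2' j) = 0"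
      using disj[of "Suc i"] by (intro sum.neutral) (auto simp: e2'_def)
    then show ?thesis by (simp add: sum_X e2'_def)
  qed
  have c'2: "c' l = 0" if "l \<in> X2 i" for l
    using e2[OF that] sum_e2' by (simp add: c'_def)
  have "(\<Sum>j\<in>X1 (Suc p). m p l j * c' j) = 0" if p: "i = Suc p" and l: "l \<in> X1 p" for p l
  proof -
    have lX: "l \<in> X p" using l un by auto
    have "(\<Sum>j\<in>X1 (Suc p). m p l j * c' j) = (\<Sum>j\<in>X (Suc p). m p l j * c' j)"
      using c'2 p by (simp add: sum_X)
    also have "\<dots> = (\<Sum>j\<in>X (Suc p). m p l j * c j)"
      using sum_square[OF lX, of e2'] p
      by (simp add: c'_def right_diff_distrib sum_subtractf)
    finally show ?thesis using cyc[OF p lX] by simp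
  qed
  then obtain e1 where e1: "\<And>l. l \<in> X1 i \<Longrightarrow> c' l = (\<Sum>j\<in>X1 (Suc i). m i l j * e1 j)"
    using not_homology_nonzeroE[of m X1 i c'] neg by blast
  define e where "e j = (if j \<in> X1 (Suc i) then e1 j else e2 j)" for j
  have e_sum: "(\<Sum>j\<in>X (Suc i). m i l j * e j)
      = (\<Sum>j\<in>X1 (Suc i). m i l j * e1 j) + (\<Sum>j\<in>X2 (Suc i). m i l j * e2 j)" for l
  proof -
    have "(\<Sum>j\<in>X2 (Suc i). m i l j * e j) = (\<Sum>j\<in>X2 (Suc i). m i l j * e2 j)"
      using disj[of "Suc i"] by (intro sum.cong) (auto simp: e_def)
    then show ?thesis by (simp add: sum_X e_def)
  qed
  have "c l = (\<Sum>j\<in>X (Suc i). m i l j * e j)" if "l \<in> X i" for l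
  proof (cases "l \<in> X1 i")
    case True
    then show ?thesis using e1[OF True] unfolding e_sum c'_def sum_e2' by (simp add: diff_eq_eq)
  next
    case False
    then have "l \<in> X2 i" using that un by auto
    then show ?thesis using e2 by (simp add: e_sum sub)
  qed
  then show False using nb by blast
qed

text \<open>If a cycle of \<open>X1\<close> is the boundary of \<open>e\<close> in \<open>X\<close>,
  the \<open>X2\<close> part of \<open>e\<close> is a quotient cycle in degree \<open>Suc i\<close>.
  When that one bounds, \<open>e\<close> can be changed by a boundary until it is supported on
  \<open>X1\<close>.\<close>

lemma exact_sub:
  assumes "homology_nonzero m X1 i"
  shows "homology_nonzero m X i \<or> homology_nonzero m X2 (Suc i)"
proof (rule ccontr)
  assume neg: "\<not> ?thesis"
  obtain c where cyc: "\<And>p l. i = Suc p \<Longrightarrow> l \<in> X1 p \<Longrightarrow> (\<Sum>j\<in>X1 (Suc p). m p l j * c j) = 0"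
    and nb: "\<And>e. \<exists>l\<in>X1 i. c l \<noteq> (\<Sum>j\<in>X1 (Suc i). m i l j * e j)"
    using homology_nonzeroE[OF assms] by blast
  define z where "z j = (if j \<in> X1 i then c j else 0)" for j
  have "(\<Sum>j\<in>X (Suc p). m p l j * z j) = 0" if p: "i = Suc p" and l: "l \<in> X p" for p l
  proof -
    have "(\<Sum>j\<in>X2 (Suc p). m p l j * z j) = 0"
      using disj[of i] p by (intro sum.neutral) (auto simp: z_def)
    then have *: "(\<Sum>j\<in>X (Suc p). m p l j * z j) = (\<Sum>j\<in>X1 (Suc p). m p l j * c j)"
      using p by (simp add: sum_X z_def)
    show ?thesis
      unfolding * using cyc[OF p] sub l un by (cases "l \<in> X1 p") auto
  qed
  then obtain e where e: "\<And>l. l \<in> X i \<Longrightarrow> z l = (\<Sum>j\<in>X (Suc i). m i l j * e j)"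
    using not_homology_nonzeroE[of m X i z] neg by blast
  have "(\<Sum>j\<in>X2 (Suc p). m p l j * e j) = 0" if p: "Suc i = Suc p" and l: "l \<in> X2 p" for p l
    proof -
    have "l \<in> X i" "l \<notin> X1 i" using p l un[of i] disj[of i] by auto
    then show ?thesis using e[of l] p sum_X2[OF l, of e] by (simp add: z_def)
  qed
  then obtain f where f: "\<And>l. l \<in> X2 (Suc i) \<Longrightarrow> e l = (\<Sum>j\<in>X2 (Suc (Suc i)). m (Suc i) l j * f j)"
    using not_homology_nonzeroE[of m X2 "Suc i" e] neg by blast
  define f' where "f' j = (if j \<in> X2 (Suc (Suc i)) then f j else 0)" for j
  define e' where "e' l = e l - (\<Sum>j\<in>X (Suc (Suc i)). m (Suc i) l j * f' j)" for l
  have sum_f': "(\<Sum>j\<in>X (Suc (Suc i)). m (Suc i) l j * f' j)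
      = (\<Sum>j\<in>X2 (Suc (Suc i)). m (Suc i) l j * f j)" for l
  proof -
    have "(\<Sum>j\<in>X1 (Suc (Suc i)). m (Suc i) l j * f' j) = 0"
      using disj[of "Suc (Suc i)"] by (intro sum.neutral) (auto simp: f'_def)
    then show ?thesis by (simp add: sum_X f'_def)
  qed
  have e'2: "e' l = 0" if "l \<in> X2 (Suc i)" for l
    using f[OF that] sum_f' by (simp add: e'_def)
  have "c l = (\<Sum>j\<in>X1 (Suc i). m i l j * e' j)" if l: "l \<in> X1 i" for l
  proof -
    have lX: "l \<in> X i" using l un by auto
    have "(\<Sum>j\<in>X1 (Suc i). m i l j * e' j) = (\<Sum>j\<in>X (Suc i). m i l j * e' j)"
      using e'2 by (simp add: sum_X)
    also have "\<dots> = (\<Sum>j\<in>X (Suc i). m i l j * e j)"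
      using sum_square[OF lX, of f'] by (simp add: e'_def right_diff_distrib sum_subtractf)
    also have "\<dots> = c l" using e[OF lX] l by (simp add: z_def)
    finally show ?thesis ..
  qed
  then show False using nb by blast
qed

text \<open>Lift a quotient cycle by zero. The boundary \<open>b\<close> of the lift is a cycle of
  \<open>X1\<close>; if \<open>b\<close> is the boundary of \<open>e\<close> there, subtracting
  \<open>e\<close> turns the lift into a cycle of \<open>X\<close>. In degree 0 no correction
  arises.\<close>

lemma exact_quotient:
  assumes "homology_nonzero m X2 i"
  shows "homology_nonzero m X i \<or> (\<exists>p. i = Suc p \<and> homology_nonzero m X1 p)"
proof (rule ccontr)
  assume neg: "\<not> ?thesis"
  obtain c where cyc: "\<And>p l. i = Suc p \<Longrightarrow> l \<in> X2 p \<Longrightarrow> (\<Sum>j\<in>X2 (Suc p). m p l j * c j) = 0"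
    and nb: "\<And>e. \<exists>l\<in>X2 i. c l \<noteq> (\<Sum>j\<in>X2 (Suc i). m i l j * e j)"
    using homology_nonzeroE[OF assms] by blast
  define z0 where "z0 j = (if j \<in> X2 i then c j else 0)" for j
  have z0_sum: "(\<Sum>j\<in>X (Suc p). m p l j * z0 j) = (\<Sum>j\<in>X2 (Suc p). m p l j * c j)"
    if "i = Suc p" for p l
  proof -
    have "(\<Sum>j\<in>X1 (Suc p). m p l j * z0 j) = 0"
      using disj[of i] that by (intro sum.neutral) (auto simp: z0_def)
    then show ?thesis using that by (simp add: sum_X z0_def)
  qed
  have "\<exists>z. (\<forall>l\<in>X2 i. z l = c l) \<and>
      (\<forall>p l. i = Suc p \<longrightarrow> l \<in> X p \<longrightarrow> (\<Sum>j\<in>X (Suc p). m p l j * z j) = 0)"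
  proof (cases i)
    case 0
    then show ?thesis by auto
  next
    case i: (Suc p)
    define b where "b l = (\<Sum>j\<in>X (Suc p). m p l j * z0 j)" for l
    have b2: "b l = 0" if "l \<in> X2 p" for l
      using cyc[OF i that] z0_sum[OF i] by (simp add: b_def)
    have "(\<Sum>j\<in>X1 (Suc q). m q l j * b j) = 0" if q: "p = Suc q" and l: "l \<in> X1 q" for q l
    proof -
      have lX: "l \<in> X q" using l un by auto
      have "(\<Sum>j\<in>X1 (Suc q). m q l j * b j) = (\<Sum>j\<in>X (Suc q). m q l j * b j)"
        using b2 q by (simp add: sum_X)
      also have "\<dots> = 0" using sum_square[OF lX, of z0] q by (simp add: b_def)
      finally show ?thesis .
    qed
    then obtain e where e: "\<And>l. l \<in> X1 p \<Longrightarrow> b l = (\<Sum>j\<in>X1 (Suc p). m p l j * e j)"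
      using not_homology_nonzeroE[of m X1 p b] neg i by blast
    define z where "z j = (if j \<in> X2 i then c j else - e j)" for j
    have z_sum: "(\<Sum>j\<in>X (Suc p). m p l j * z j) = b l - (\<Sum>j\<in>X1 (Suc p). m p l j * e j)" for l
    proof -
      have "(\<Sum>j\<in>X1 (Suc p). m p l j * z j) = (\<Sum>j\<in>X1 (Suc p). - (m p l j * e j))"
        using disj[of i] i by (intro sum.cong) (auto simp: z_def)
      moreover have "(\<Sum>j\<in>X2 (Suc p). m p l j * z j) = (\<Sum>j\<in>X2 (Suc p). m p l j * c j)"
        using i by (intro sum.cong) (auto simp: z_def)
      ultimately show ?thesis using z0_sum[OF i]
        by (simp add: sum_X[of "\<lambda>j. m p l j * z j"] b_def sum_negf)
    qed
    have "(\<Sum>j\<in>X (Suc p). m p l j * z j) = 0" if "l \<in> X p" for l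
      using that e[of l] b2[of l] sub[of l p] un[of p] unfolding z_sum by (cases "l \<in> X1 p") auto
    then show ?thesis using i by (intro exI[of _ z]) (auto simp: z_def)
  qed
  then obtain z where z: "\<And>l. l \<in> X2 i \<Longrightarrow> z l = c l"
    and zc: "\<And>p l. i = Suc p \<Longrightarrow> l \<in> X p \<Longrightarrow> (\<Sum>j\<in>X (Suc p). m p l j * z j) = 0" by blast
  obtain f where f: "\<And>l. l \<in> X i \<Longrightarrow> z l = (\<Sum>j\<in>X (Suc i). m i l j * f j)"
    using not_homology_nonzeroE[of m X i z] neg zc by blast
  have "c l = (\<Sum>j\<in>X2 (Suc i). m i l j * f j)" if "l \<in> X2 i" for l
    using f[of l] z[OF that] sum_X2[OF that, of f] that by (simp add: un)
  then show False using nb by blast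
qed

end

section \<open>Homogeneous polynomials and monomial ideals\<close>

text \<open>Evaluation at the point with all coordinates 1. It is injective on each multidegree
  component of \<open>S\<close>, which is at most one-dimensional
  (\<open>homogeneous_eqI\<close>).\<close>

definition coeff_sum :: "('a \<Rightarrow>\<^sub>0 'k::comm_monoid_add) \<Rightarrow> 'k" where
  "coeff_sum f = (\<Sum>m\<in>Poly_Mapping.keys f. Poly_Mapping.lookup f m)"

lemma coeff_sum_zero [simp]: "coeff_sum 0 = 0"
  by (simp add: coeff_sum_def)

lemma coeff_sum_single [simp]: "coeff_sum (Poly_Mapping.single m c) = c"
  by (simp add: coeff_sum_def)

lemma coeff_sum_add: "coeff_sum (f + g) = coeff_sum f + coeff_sum g"
  unfolding coeff_sum_def by (rule setsum_keys_plus_distrib) auto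

lemma coeff_sum_sum: "coeff_sum (\<Sum>x\<in>A. f x) = (\<Sum>x\<in>A. coeff_sum (f x))"
  by (induction A rule: infinite_finite_induct) (auto simp: coeff_sum_add)

text \<open>Negative entries are truncated to 0, hence the sign guard in
  \<open>homogeneous_term\<close>: the component of \<open>S\<close> in a multidegree with a
  negative entry is zero.\<close>

definition nat_exponent :: "('n::finite \<Rightarrow> int) \<Rightarrow> ('n \<Rightarrow>\<^sub>0 nat)" where
  "nat_exponent b = Abs_poly_mapping (\<lambda>s. nat (b s))"

lemma lookup_nat_exponent [simp]: "Poly_Mapping.lookup (nat_exponent b) s = nat (b s)"
  unfolding nat_exponent_def by (subst lookup_Abs_poly_mapping) auto

lemma nat_exponent_lookup [simp]: "nat_exponent (\<lambda>s. int (Poly_Mapping.lookup x s)) = x"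
  by (rule poly_mapping_eqI) simp

definition homogeneous_term :: "('n::finite \<Rightarrow> int) \<Rightarrow> 'k \<Rightarrow> ('n, 'k::comm_ring_1) polyring" where
  "homogeneous_term b c = (if \<forall>s. 0 \<le> b s then Poly_Mapping.single (nat_exponent b) c else 0)"

lemma homogeneous_homogeneous_term: "homogeneous b (homogeneous_term b c)"
  by (auto simp: homogeneous_def homogeneous_term_def)

lemma homogeneous_zero [simp]: "homogeneous b 0"
  by (simp add: homogeneous_def)

lemma homogeneous_add: "homogeneous b f \<Longrightarrow> homogeneous b g \<Longrightarrow> homogeneous b (f + g)"
  using keys_add[of f g] unfolding homogeneous_def by blast

lemma homogeneous_sum: "(\<And>x. x \<in> A \<Longrightarrow> homogeneous b (f x)) \<Longrightarrow> homogeneous b (\<Sum>x\<in>A. f x)"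
  by (induction A rule: infinite_finite_induct) (auto intro: homogeneous_add)

lemma homogeneous_eq:
  fixes f :: "('n::finite, 'k::comm_ring_1) polyring"
  assumes "homogeneous b f"
  shows "f = homogeneous_term b (coeff_sum f)"
proof (cases "f = 0")
  case True
  then show ?thesis by (simp add: homogeneous_term_def)
next
  case False
  then obtain x where x: "x \<in> Poly_Mapping.keys f"
    by (metis lookup_not_eq_zero_eq_in_keys lookup_zero poly_mapping_eqI)
  have b: "b = (\<lambda>s. int (Poly_Mapping.lookup x s))"
    using assms x by (auto simp: homogeneous_def)
  have "Poly_Mapping.keys f = {x}"
    using assms x unfolding homogeneous_def b by (auto intro: poly_mapping_eqI)
  then have "f = Poly_Mapping.single x (coeff_sum f)"
    by (intro poly_mapping_eqI)
      (auto simp: coeff_sum_def lookup_single when_def in_keys_iff)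
  then show ?thesis by (simp add: homogeneous_term_def b)
qed

lemma homogeneous_eqI:
  fixes f g :: "('n::finite, 'k::comm_ring_1) polyring"
  assumes "homogeneous b f" "homogeneous b g" "coeff_sum f = coeff_sum g"
  shows "f = g"
  using homogeneous_eq[OF assms(1)] homogeneous_eq[OF assms(2)] assms(3) by simp

lemma coeff_sum_homogeneous_term:
  "coeff_sum (homogeneous_term b c) = (if \<forall>s. 0 \<le> b s then c else 0)"
  by (simp add: homogeneous_term_def)

lemma homogeneous_term_mult:
  fixes b d :: "'n::finite \<Rightarrow> int" and c e :: "'k::comm_ring_1"
  assumes "\<forall>s. 0 \<le> b s" "\<forall>s. 0 \<le> d s"
  shows "homogeneous_term b c * homogeneous_term d e = homogeneous_term (\<lambda>s. b s + d s) (c * e)"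
proof -
  have "nat_exponent b + nat_exponent d = nat_exponent (\<lambda>s. b s + d s)"
    using assms by (intro poly_mapping_eqI) (simp add: lookup_add nat_add_distrib)
  then show ?thesis using assms by (simp add: homogeneous_term_def mult_single)
qed

lemma homogeneous_term_neg: "\<not> (\<forall>s. 0 \<le> b s) \<Longrightarrow> homogeneous_term b c = 0"
  unfolding homogeneous_term_def by (rule if_not_P)

lemma
  fixes f g :: "('n::finite, 'k::comm_ring_1) polyring"
  assumes "homogeneous b f" "homogeneous d g"
  shows homogeneous_mult: "homogeneous (\<lambda>s. b s + d s) (f * g)"
    and coeff_sum_mult: "coeff_sum (f * g) = coeff_sum f * coeff_sum g"
proof -
  have f: "f = homogeneous_term b (coeff_sum f)" and g: "g = homogeneous_term d (coeff_sum g)"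
    using assms homogeneous_eq by blast+
  \<comment> \<open>\<open>b + d\<close> can be nonnegative while \<open>b\<close> or
    \<open>d\<close> is not; one of the factors is then already 0.\<close>
  have "f * g = homogeneous_term (\<lambda>s. b s + d s) (coeff_sum f * coeff_sum g) \<and> (\<forall>s. 0 \<le> b s + d s)
      \<or> f * g = 0 \<and> (f = 0 \<or> g = 0)"
    using homogeneous_term_mult[of b d "coeff_sum f" "coeff_sum g"] f g homogeneous_term_neg
    by (metis add_nonneg_nonneg mult_zero_left mult_zero_right)
  then show "homogeneous (\<lambda>s. b s + d s) (f * g)" "coeff_sum (f * g) = coeff_sum f * coeff_sum g"
    using homogeneous_homogeneous_term by (fastforce simp: coeff_sum_homogeneous_term)+
qed

text \<open>Projection to a multidegree component, used to replace an arbitrary preimage under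
  \<open>bd F\<close> by a homogeneous one (\<open>homogeneous_boundary\<close>).\<close>

definition homogeneous_part :: "('n::finite \<Rightarrow> int) \<Rightarrow> ('n, 'k::comm_ring_1) polyring \<Rightarrow> ('n, 'k) polyring" where
  "homogeneous_part b f = homogeneous_term b (Poly_Mapping.lookup f (nat_exponent b))"

lemma homogeneous_part_sum:
  "homogeneous_part b (\<Sum>x\<in>A. f x) = (\<Sum>x\<in>A. homogeneous_part b (f x))"
proof -
  have "homogeneous_part b 0 = 0"
    by (simp add: homogeneous_part_def homogeneous_term_def)
  moreover have "homogeneous_part b (f + g) = homogeneous_part b f + homogeneous_part b g"
    for f g :: "('a, 'b) polyring"
    by (simp add: homogeneous_part_def homogeneous_term_def lookup_add single_add)
  ultimately show ?thesis
    by (induction A rule: infinite_finite_induct) auto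
qed

lemma homogeneous_part_id: "homogeneous b f \<Longrightarrow> homogeneous_part b f = f"
  using homogeneous_eq[of b f] unfolding homogeneous_part_def
  by (metis homogeneous_term_def lookup_single_eq)

lemma homogeneous_part_homogeneous: "homogeneous b (homogeneous_part b f)"
  by (simp add: homogeneous_part_def homogeneous_homogeneous_term)

lemma lookup_single_mult_add:
  fixes f :: "('n, 'k::comm_ring_1) polyring"
  shows "Poly_Mapping.lookup (Poly_Mapping.single x c * f) (x + y) = c * Poly_Mapping.lookup f y"
  by (simp add: lookup_mult lookup_single when_mult)

lemma lookup_single_mult_nonzeroD:
  fixes f :: "('n, 'k::comm_ring_1) polyring"
  assumes "Poly_Mapping.lookup (Poly_Mapping.single x c * f) z \<noteq> 0"
  shows "\<exists>y. z = x + y"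
  using assms keys_mult[of "Poly_Mapping.single x c" f]
  by (auto simp: in_keys_iff lookup_single split: if_splits)

lemma homogeneous_part_mult:
  fixes f g :: "('n::finite, 'k::comm_ring_1) polyring"
  assumes f: "homogeneous b f"
  shows "homogeneous_part (\<lambda>s. b s + d s) (f * g) = f * homogeneous_part d g"
proof (cases "\<forall>s. 0 \<le> b s")
  case False
  then have "f = 0" using homogeneous_eq[OF f] homogeneous_term_neg by metis
  then show ?thesis by (simp add: homogeneous_part_def homogeneous_term_def)
next
  case b: True
  define x where "x = nat_exponent b"
  define c where "c = coeff_sum f"
  have fx: "f = Poly_Mapping.single x c"
    using homogeneous_eq[OF f] b by (simp add: homogeneous_term_def x_def c_def)
  show ?thesis
  proof (cases "\<forall>s. 0 \<le> d s")
    case True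
    have "nat_exponent (\<lambda>s. b s + d s) = x + nat_exponent d"
      using b True by (intro poly_mapping_eqI) (simp add: lookup_add nat_add_distrib x_def)
    then have "homogeneous_part (\<lambda>s. b s + d s) (f * g)
      = homogeneous_term (\<lambda>s. b s + d s) (c * Poly_Mapping.lookup g (nat_exponent d))"
      by (simp add: homogeneous_part_def fx lookup_single_mult_add)
    also have "\<dots> = f * homogeneous_part d g"
      using homogeneous_eq[OF f] homogeneous_term_mult[OF b True] c_def
      by (metis homogeneous_part_def)
    finally show ?thesis .
  next
    case False
    then obtain s where s: "d s < 0" by (auto simp: not_le)
    \<comment> \<open>Every monomial of \<open>f * g\<close> is divisible by the one with exponent
      \<open>b\<close>, but the monomial with exponent \<open>b + d\<close> is not, since
      \<open>d s\<close> is negative.\<close>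
    have "Poly_Mapping.lookup (f * g) (nat_exponent (\<lambda>s. b s + d s)) = 0" if "\<forall>s. 0 \<le> b s + d s"
    proof (rule ccontr)
      assume "\<not> ?thesis"
      then obtain y where y: "nat_exponent (\<lambda>s. b s + d s) = x + y"
        using lookup_single_mult_nonzeroD unfolding fx by blast
      have "nat (b s + d s) = nat (b s) + Poly_Mapping.lookup y s"
        using arg_cong[OF y, of "\<lambda>z. Poly_Mapping.lookup z s"] by (simp add: lookup_add x_def)
      then show False using s b[rule_format, of s] that[rule_format, of s] by linarith
    qed
    then have "homogeneous_part (\<lambda>s. b s + d s) (f * g) = 0"
      by (auto simp: homogeneous_part_def homogeneous_term_def)
    then show ?thesis using False by (simp add: homogeneous_part_def homogeneous_term_neg)
  qed
qed

section \<open>Membership in monomial ideals\<close>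

lemma mem_span_monomials:
  fixes f :: "('n, 'k::comm_ring_1) polyring"
  shows "f \<in> ideal.span (monomial ` A) \<longleftrightarrow> (\<forall>m\<in>Poly_Mapping.keys f. \<exists>x\<in>A. \<exists>y. m = x + y)"
proof
  define T where "T = {f :: ('n, 'k) polyring. \<forall>m\<in>Poly_Mapping.keys f. \<exists>x\<in>A. \<exists>y. m = x + y}"
  have "ideal.subspace T"
  proof (rule ideal.subspaceI)
    show "0 \<in> T" by (simp add: T_def)
    show "f + g \<in> T" if "f \<in> T" "g \<in> T" for f g
      using that keys_add[of f g] unfolding T_def by blast
    show "h * f \<in> T" if "f \<in> T" for h f
    proof -
      have "\<exists>x\<in>A. \<exists>y. m = x + y" if m: "m \<in> Poly_Mapping.keys (h * f)" for m
      proof -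
        obtain a b where ab: "m = a + b" "b \<in> Poly_Mapping.keys f"
          using m keys_mult[of h f] by blast
        then obtain x y where "x \<in> A" "b = x + y" using \<open>f \<in> T\<close> unfolding T_def by blast
        then show ?thesis using ab by (intro bexI[of _ x] exI[of _ "a + y"]) (auto simp: algebra_simps)
      qed
      then show ?thesis by (simp add: T_def)
    qed
  qed
  moreover have "monomial ` A \<subseteq> T"
    by (auto simp: T_def monomial_def intro!: exI[of _ 0])
  ultimately have "ideal.span (monomial ` A) \<subseteq> T"
    by (intro ideal.span_minimal)
  then show "f \<in> ideal.span (monomial ` A) \<Longrightarrow> \<forall>m\<in>Poly_Mapping.keys f. \<exists>x\<in>A. \<exists>y. m = x + y"
    by (auto simp: T_def)
next
  assume *: "\<forall>m\<in>Poly_Mapping.keys f. \<exists>x\<in>A. \<exists>y. m = x + y"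
  have "f = (\<Sum>m\<in>Poly_Mapping.keys f. Poly_Mapping.single m (Poly_Mapping.lookup f m))"
    by (rule poly_mapping_eqI)
      (simp add: lookup_sum lookup_single when_def in_keys_iff)
  moreover have "Poly_Mapping.single m c \<in> ideal.span (monomial ` A)"
    if "m \<in> Poly_Mapping.keys f" for m c
  proof -
    obtain x y where xy: "x \<in> A" "m = x + y" using * \<open>m \<in> Poly_Mapping.keys f\<close> by blast
    have "Poly_Mapping.single y c * monomial x \<in> ideal.span (monomial ` A)"
      using xy by (intro ideal.span_scale ideal.span_base) auto
    then show ?thesis by (simp add: monomial_def mult_single xy add.commute)
  qed
  ultimately show "f \<in> ideal.span (monomial ` A)"
    by (metis (no_types, lifting) ideal.span_sum)
qed

text \<open>The exponents of the monomials in the ideal generated by \<open>A\<close>, as integer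
  vectors: they are compared with differences \<open>a - mdeg\<close>, which may have negative
  entries.\<close>

definition up_set :: "('n \<Rightarrow>\<^sub>0 nat) set \<Rightarrow> ('n \<Rightarrow> int) set" where
  "up_set A = {b. \<exists>x\<in>A. \<forall>s. int (Poly_Mapping.lookup x s) \<le> b s}"

lemma homogeneous_mem_span_monomials:
  fixes f :: "('n::finite, 'k::comm_ring_1) polyring"
  assumes "homogeneous b f"
  shows "f \<in> ideal.span (monomial ` A) \<longleftrightarrow> coeff_sum f = 0 \<or> b \<in> up_set A"
proof (cases "f = 0")
  case True
  then show ?thesis by (simp add: ideal.span_zero)
next
  case False
  then have b: "\<forall>s. 0 \<le> b s" and f: "f = Poly_Mapping.single (nat_exponent b) (coeff_sum f)"
    using homogeneous_eq[OF assms] homogeneous_term_neg by (metis, metis homogeneous_term_def)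
  have c: "coeff_sum f \<noteq> 0" using f False by auto
  then have k: "Poly_Mapping.keys f = {nat_exponent b}" by (subst f) simp
  have "(\<exists>y. nat_exponent b = x + y) \<longleftrightarrow> (\<forall>s. int (Poly_Mapping.lookup x s) \<le> b s)" for x
  proof
    assume "\<exists>y. nat_exponent b = x + y"
    then obtain y where y: "nat_exponent b = x + y" by blast
    show "\<forall>s. int (Poly_Mapping.lookup x s) \<le> b s"
    proof
      fix s
      have "nat (b s) = Poly_Mapping.lookup x s + Poly_Mapping.lookup y s"
        using arg_cong[OF y, of "\<lambda>z. Poly_Mapping.lookup z s"] by (simp add: lookup_add)
      then show "int (Poly_Mapping.lookup x s) \<le> b s" using b[rule_format, of s] by linarith
    qed
  next
    assume "\<forall>s. int (Poly_Mapping.lookup x s) \<le> b s"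
    then have "Poly_Mapping.lookup x s \<le> nat (b s)" for s
      using nat_mono[of "int (Poly_Mapping.lookup x s)" "b s"] by simp
    then have "nat_exponent b = x + (nat_exponent b - x)"
      by (intro poly_mapping_eqI) (simp add: lookup_add lookup_minus)
    then show "\<exists>y. nat_exponent b = x + y" by blast
  qed
  then show ?thesis using c by (simp add: mem_span_monomials k up_set_def)
qed

section \<open>Multigraded strands\<close>

text \<open>In multidegree \<open>a\<close> the basis element \<open>e_j\<close> can only carry
  multiples of the single monomial with exponent \<open>a - mdeg F i j\<close>.\<close>

definition chain_basis ::
  "('n, 'k::comm_ring_1) free_complex \<Rightarrow> ('n \<Rightarrow> int) set \<Rightarrow> ('n \<Rightarrow> int) \<Rightarrow> nat \<Rightarrow> nat set" where
  "chain_basis F W a i = {j. j < rk F i \<and> (\<lambda>s. a s - mdeg F i j s) \<in> W}"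

definition bd_coeff :: "('n, 'k::comm_ring_1) free_complex \<Rightarrow> nat \<Rightarrow> nat \<Rightarrow> nat \<Rightarrow> 'k" where
  "bd_coeff F p l j = coeff_sum (bd F (Suc p) $$ (l, j))"

text \<open>Dehomogenisation at \<open>x = (1, \<dots>, 1)\<close> turns the component of multidegree \<open>a\<close> of
  \<open>F \<otimes> J\<close> into the complex of \<open>K\<close>-vector spaces with basis \<open>chain_basis F W a\<close>, where \<open>W\<close> is the
  set of exponents of \<open>J\<close>. A convex \<open>W\<close> corresponds to a quotient of two monomial ideals.\<close>

abbreviation strand_nonzero ::
  "('n, 'k::field) free_complex \<Rightarrow> nat \<Rightarrow> ('n \<Rightarrow> int) set \<Rightarrow> ('n \<Rightarrow> int) \<Rightarrow> bool" where
  "strand_nonzero F i W a \<equiv> homology_nonzero (bd_coeff F) (chain_basis F W a) i"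

lemma finite_chain_basis [simp]: "finite (chain_basis F W a i)"
  by (simp add: chain_basis_def)

lemma shift_image_iff:
  fixes W :: "('n \<Rightarrow> int) set"
  shows "b \<in> (\<lambda>b s. b s + d s) ` W \<longleftrightarrow> (\<lambda>s. b s - d s) \<in> W"
proof
  assume "(\<lambda>s. b s - d s) \<in> W"
  then show "b \<in> (\<lambda>b s. b s + d s) ` W" by (intro image_eqI[where x = "\<lambda>s. b s - d s"]) auto
qed auto

text \<open>Multiplication by a monomial only relabels multidegrees: both sides have the same chain
  basis.\<close>

lemma strand_nonzero_shift:
  "strand_nonzero F i ((\<lambda>b s. b s + d s) ` W) a \<longleftrightarrow> strand_nonzero F i W (\<lambda>s. a s - d s)"
proof -
  have "chain_basis F ((\<lambda>b s. b s + d s) ` W) a = chain_basis F W (\<lambda>s. a s - d s)"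
    unfolding chain_basis_def shift_image_iff by (simp add: algebra_simps)
  then show ?thesis by simp
qed

definition convex_exponents :: "('n \<Rightarrow> int) set \<Rightarrow> bool" where
  "convex_exponents W \<longleftrightarrow> (\<forall>b\<in>W. \<forall>d\<in>W. \<forall>c. (\<forall>s. b s \<le> c s) \<and> (\<forall>s. c s \<le> d s) \<longrightarrow> c \<in> W)"

section \<open>Strands of a graded free complex as complexes over \<open>K\<close>\<close>

locale graded_complex =
  fixes F :: "('n::finite, 'k::field) free_complex"
  assumes graded: "graded_free_complex F"
begin

lemma bd_carrier: "bd F (Suc p) \<in> carrier_mat (rk F p) (rk F (Suc p))"
  and bd_homogeneous: "l < rk F p \<Longrightarrow> j < rk F (Suc p) \<Longrightarrow>
    homogeneous (\<lambda>s. mdeg F (Suc p) j s - mdeg F p l s) (bd F (Suc p) $$ (l, j))"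
  and bd_bd: "bd F p * bd F (Suc p) = 0\<^sub>m (dim_row (bd F p)) (rk F (Suc p))"
  using graded unfolding graded_free_complex_def by auto

lemma bd_carrier_0: "bd F 0 \<in> carrier_mat 0 (rk F 0)"
  using graded unfolding graded_free_complex_def by auto

lemma dim_row_bd_Suc [simp]: "dim_row (bd F (Suc p)) = rk F p"
  and dim_col_bd [simp]: "dim_col (bd F p) = rk F p"
  using bd_carrier bd_carrier_0 by (auto, cases p, auto)

lemma bd_index:
  assumes "l < rk F p" "w \<in> carrier_vec (rk F (Suc p))"
  shows "(bd F (Suc p) *\<^sub>v w) $ l = (\<Sum>j<rk F (Suc p). bd F (Suc p) $$ (l, j) * w $ j)"
  using assms bd_carrier[of p]
  by (auto simp: scalar_prod_def lessThan_atLeast0 intro!: sum.cong)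

lemma bd_coeff_nonzeroD:
  assumes "l < rk F p" "j < rk F (Suc p)" "bd_coeff F p l j \<noteq> 0"
  shows "mdeg F p l s \<le> mdeg F (Suc p) j s"
proof -
  have "bd F (Suc p) $$ (l, j) \<noteq> 0" using assms(3) unfolding bd_coeff_def by auto
  then have "\<forall>s. 0 \<le> mdeg F (Suc p) j s - mdeg F p l s"
    using homogeneous_eq[OF bd_homogeneous[OF assms(1,2)]] homogeneous_term_neg by metis
  then show ?thesis by simp
qed

lemma bd_coeff_square:
  assumes h: "h < rk F p" and j: "j < rk F (Suc (Suc p))"
  shows "(\<Sum>l<rk F (Suc p). bd_coeff F p h l * bd_coeff F (Suc p) l j) = 0"
proof -
  have "0 = coeff_sum ((bd F (Suc p) * bd F (Suc (Suc p))) $$ (h, j))"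
    using h j by (simp add: bd_bd)
  also have "(bd F (Suc p) * bd F (Suc (Suc p))) $$ (h, j)
      = (\<Sum>l<rk F (Suc p). bd F (Suc p) $$ (h, l) * bd F (Suc (Suc p)) $$ (l, j))"
    using h j by (simp add: scalar_prod_def lessThan_atLeast0)
  also have "coeff_sum \<dots> = (\<Sum>l<rk F (Suc p). bd_coeff F p h l * bd_coeff F (Suc p) l j)"
    unfolding coeff_sum_sum bd_coeff_def
    using h j by (intro sum.cong refl coeff_sum_mult[OF bd_homogeneous bd_homogeneous]) auto
  finally show ?thesis ..
qed

text \<open>An \<open>l\<close> with nonzero product has its exponent between those of
  \<open>j\<close> and \<open>h\<close>, so convexity puts it into the chain basis. The restricted
  sum is therefore the full one.\<close>

lemma chain_basis_square:
  assumes W: "convex_exponents W"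
    and h: "h \<in> chain_basis F W a p" and j: "j \<in> chain_basis F W a (Suc (Suc p))"
  shows "(\<Sum>l\<in>chain_basis F W a (Suc p). bd_coeff F p h l * bd_coeff F (Suc p) l j) = 0"
proof -
  have hj: "h < rk F p" "j < rk F (Suc (Suc p))"
    using h j by (auto simp: chain_basis_def)
  have "(\<Sum>l\<in>chain_basis F W a (Suc p). bd_coeff F p h l * bd_coeff F (Suc p) l j)
      = (\<Sum>l<rk F (Suc p). bd_coeff F p h l * bd_coeff F (Suc p) l j)"
  proof (intro sum.mono_neutral_left ballI)
    fix l assume l: "l \<in> {..<rk F (Suc p)} - chain_basis F W a (Suc p)"
    show "bd_coeff F p h l * bd_coeff F (Suc p) l j = 0"
    proof (rule ccontr)
      assume nz: "\<not> ?thesis"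
      have "(\<lambda>s. a s - mdeg F (Suc p) l s) \<in> W"
        using W[unfolded convex_exponents_def, rule_format,
            of "\<lambda>s. a s - mdeg F (Suc (Suc p)) j s" "\<lambda>s. a s - mdeg F p h s"]
          h j l nz hj bd_coeff_nonzeroD[of h p l] bd_coeff_nonzeroD[of l "Suc p" j]
        by (simp add: chain_basis_def)
      then show False using l by (simp add: chain_basis_def)
    qed
  qed (auto simp: chain_basis_def)
  then show ?thesis using bd_coeff_square[OF hj] by simp
qed

text \<open>The differential lowers \<open>mdeg\<close> and so raises the exponent
  \<open>a - mdeg\<close>. Hence an upward closed part of \<open>W\<close> is preserved, and its
  complement describes the quotient.\<close>

lemma subcomplexI:
  assumes W: "convex_exponents W" and un: "W = W1 \<union> W2" and disj: "W1 \<inter> W2 = {}"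
    and up: "\<And>b c. b \<in> W1 \<Longrightarrow> c \<in> W \<Longrightarrow> (\<forall>s. b s \<le> c s) \<Longrightarrow> c \<in> W1"
  shows "subcomplex (bd_coeff F) (chain_basis F W a) (chain_basis F W1 a) (chain_basis F W2 a)"
proof
  fix p l j
  assume l: "l \<in> chain_basis F W2 a p" and j: "j \<in> chain_basis F W1 a (Suc p)"
  show "bd_coeff F p l j = 0"
  proof (rule ccontr)
    assume "bd_coeff F p l j \<noteq> 0"
    then have "\<forall>s. a s - mdeg F (Suc p) j s \<le> a s - mdeg F p l s"
      using bd_coeff_nonzeroD[of l p j] l j by (simp add: chain_basis_def)
    then have "(\<lambda>s. a s - mdeg F p l s) \<in> W1"
      using up[of "\<lambda>s. a s - mdeg F (Suc p) j s" "\<lambda>s. a s - mdeg F p l s"] l j un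
      by (simp add: chain_basis_def)
    then show False using l disj by (auto simp: chain_basis_def)
  qed
next
  show "(\<Sum>l\<in>chain_basis F W a (Suc p). bd_coeff F p h l * bd_coeff F (Suc p) l j) = 0"
    if "h \<in> chain_basis F W a p" "j \<in> chain_basis F W a (Suc (Suc p))" for p h j
    using chain_basis_square[OF W that] .
qed (use un disj in \<open>auto simp: chain_basis_def\<close>)

lemma tensor_chains_iff:
  "v \<in> tensor_chains F (ideal.span (monomial ` A)) i a \<longleftrightarrow>
     v \<in> carrier_vec (rk F i) \<and>
     (\<forall>j<rk F i. homogeneous (\<lambda>s. a s - mdeg F i j s) (v $ j) \<and>
        (coeff_sum (v $ j) = 0 \<or> j \<in> chain_basis F (up_set A) a i))"
  unfolding tensor_chains_def chain_basis_def
  using homogeneous_mem_span_monomials by auto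

lemma bd_tensor_chain:
  assumes w: "w \<in> tensor_chains F (ideal.span (monomial ` A)) (Suc p) a"
  shows "bd F (Suc p) *\<^sub>v w \<in> tensor_chains F (ideal.span (monomial ` A)) p a"
    and "l < rk F p \<Longrightarrow> coeff_sum ((bd F (Suc p) *\<^sub>v w) $ l)
          = (\<Sum>j\<in>chain_basis F (up_set A) a (Suc p). bd_coeff F p l j * coeff_sum (w $ j))"
proof -
  let ?J = "ideal.span (monomial ` A) :: ('n, 'k) polyring set"
  have wc: "w \<in> carrier_vec (rk F (Suc p))"
    and wJ: "\<And>j. j < rk F (Suc p) \<Longrightarrow> w $ j \<in> ?J"
    and wh: "\<And>j. j < rk F (Suc p) \<Longrightarrow> homogeneous (\<lambda>s. a s - mdeg F (Suc p) j s) (w $ j)"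
    using w by (auto simp: tensor_chains_def)
  have hom: "homogeneous (\<lambda>s. a s - mdeg F p l s) (bd F (Suc p) $$ (l, j) * w $ j)"
    and prod: "coeff_sum (bd F (Suc p) $$ (l, j) * w $ j) = bd_coeff F p l j * coeff_sum (w $ j)"
    if "l < rk F p" "j < rk F (Suc p)" for l j
    using homogeneous_mult[OF bd_homogeneous[OF that] wh[OF that(2)]]
      coeff_sum_mult[OF bd_homogeneous[OF that] wh[OF that(2)]]
    by (simp_all add: bd_coeff_def)
  show "bd F (Suc p) *\<^sub>v w \<in> tensor_chains F ?J p a"
    unfolding tensor_chains_def
    using bd_index[OF _ wc] hom wJ bd_carrier[of p] wc
    by (auto intro!: homogeneous_sum ideal.span_sum ideal.span_scale)
  show "coeff_sum ((bd F (Suc p) *\<^sub>v w) $ l)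
      = (\<Sum>j\<in>chain_basis F (up_set A) a (Suc p). bd_coeff F p l j * coeff_sum (w $ j))"
    if l: "l < rk F p"
  proof -
    have "coeff_sum ((bd F (Suc p) *\<^sub>v w) $ l)
        = (\<Sum>j<rk F (Suc p). bd_coeff F p l j * coeff_sum (w $ j))"
      unfolding bd_index[OF l wc] coeff_sum_sum using l by (intro sum.cong) (auto simp: prod)
    also have "\<dots> = (\<Sum>j\<in>chain_basis F (up_set A) a (Suc p). bd_coeff F p l j * coeff_sum (w $ j))"
      using w by (intro sum.mono_neutral_right)
        (auto simp: tensor_chains_iff chain_basis_def[of F "up_set A" a "Suc p"])
    finally show ?thesis .
  qed
qed

text \<open>Together with \<open>tensor_chain_exists\<close> this identifies the chains of
  multidegree \<open>a\<close>, via \<open>coeff_sum\<close>, with the \<open>K\<close>-valued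
  vectors on the chain basis.\<close>

lemma tensor_chain_eqI:
  assumes "v \<in> tensor_chains F (ideal.span (monomial ` A)) i a"
    and "w \<in> tensor_chains F (ideal.span (monomial ` A)) i a"
    and "\<And>j. j \<in> chain_basis F (up_set A) a i \<Longrightarrow> coeff_sum (v $ j) = coeff_sum (w $ j)"
  shows "v = w"
proof (rule eq_vecI)
  have dim: "dim_vec v = rk F i" "dim_vec w = rk F i"
    using assms(1,2) unfolding tensor_chains_def by auto
  then show "dim_vec v = dim_vec w" by simp
  fix j assume "j < dim_vec w"
  then have j: "j < rk F i" using dim by simp
  then have "coeff_sum (v $ j) = coeff_sum (w $ j)"
  proof (cases "j \<in> chain_basis F (up_set A) a i")
    case False
    then have "coeff_sum (v $ j) = 0" "coeff_sum (w $ j) = 0"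
      using assms(1,2) j unfolding tensor_chains_iff by blast+
    then show ?thesis by simp
  qed (rule assms(3))
  then show "v $ j = w $ j"
    using assms(1,2) j unfolding tensor_chains_def
    by (intro homogeneous_eqI[of "\<lambda>s. a s - mdeg F i j s"]) simp_all
qed

lemma tensor_chain_exists:
  obtains v where "v \<in> tensor_chains F (ideal.span (monomial ` A)) i a"
    and "\<And>j. j \<in> chain_basis F (up_set A) a i \<Longrightarrow> coeff_sum (v $ j) = c j"
proof -
  define v where "v = vec (rk F i) (\<lambda>j. if j \<in> chain_basis F (up_set A) a i
     then homogeneous_term (\<lambda>s. a s - mdeg F i j s) (c j) else 0)"
  have "v \<in> tensor_chains F (ideal.span (monomial ` A)) i a"
    by (auto simp: v_def tensor_chains_iff homogeneous_homogeneous_term)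
  moreover have "coeff_sum (v $ j) = c j" if "j \<in> chain_basis F (up_set A) a i" for j
  proof -
    \<comment> \<open>Exponents in an \<open>up_set\<close> dominate a vector of naturals, so
      \<open>homogeneous_term\<close> is not in its zero case.\<close>
    have "\<forall>s. 0 \<le> a s - mdeg F i j s"
      using that unfolding chain_basis_def up_set_def mem_Collect_eq
      by (meson of_nat_0_le_iff order_trans)
    then show ?thesis using that
      by (simp add: v_def coeff_sum_homogeneous_term chain_basis_def)
  qed
  ultimately show thesis by (rule that)
qed

lemma tensor_boundaries_subset:
  "tensor_boundaries F (ideal.span (monomial ` A)) i a \<subseteq> tensor_cycles F (ideal.span (monomial ` A)) i a"
proof
  fix v assume "v \<in> tensor_boundaries F (ideal.span (monomial ` A)) i a"
  then obtain w where w: "w \<in> tensor_chains F (ideal.span (monomial ` A)) (Suc i) a"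
    and v: "v = bd F (Suc i) *\<^sub>v w"
    by (auto simp: tensor_boundaries_def)
  have wc: "w \<in> carrier_vec (rk F (Suc i))" using w by (simp add: tensor_chains_def)
  have "bd F i *\<^sub>v v = (bd F i * bd F (Suc i)) *\<^sub>v w"
    unfolding v using wc bd_carrier by (intro assoc_mult_mat_vec[symmetric]) auto
  also have "\<dots> = 0\<^sub>v (dim_row (bd F i))"
    using wc by (auto simp: bd_bd intro!: eq_vecI)
  finally show "v \<in> tensor_cycles F (ideal.span (monomial ` A)) i a"
    using bd_tensor_chain(1)[OF w] v by (simp add: tensor_cycles_def)
qed

text \<open>\<open>coeff_sum\<close> is bijective on chains and turns \<open>bd F\<close> into
  \<open>bd_coeff F\<close> (\<open>bd_tensor_chain\<close>), which reduces the test to linear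
  algebra over \<open>K\<close>.\<close>

lemma tensor_cycles_neq_boundaries_iff:
  "tensor_cycles F (ideal.span (monomial ` A)) i a \<noteq> tensor_boundaries F (ideal.span (monomial ` A)) i a
     \<longleftrightarrow> strand_nonzero F i (up_set A) a"
    (is "?Z \<noteq> ?B \<longleftrightarrow> _")
proof
  let ?C = "tensor_chains F (ideal.span (monomial ` A))"
  let ?X = "chain_basis F (up_set A) a"
  assume "?Z \<noteq> ?B"
  then obtain v where vZ: "v \<in> ?Z" and vB: "v \<notin> ?B"
    using tensor_boundaries_subset by blast
  have vC: "v \<in> ?C i a" using vZ by (simp add: tensor_cycles_def)
  show "strand_nonzero F i (up_set A) a"
    unfolding homology_nonzero_def
  proof (intro exI[of _ "\<lambda>j. coeff_sum (v $ j)"] conjI allI impI ballI)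
    fix p l assume i: "i = Suc p" and l: "l \<in> ?X p"
    have "bd F (Suc p) *\<^sub>v v = 0\<^sub>v (rk F p)"
      using vZ i by (simp add: tensor_cycles_def)
    then show "(\<Sum>j\<in>?X (Suc p). bd_coeff F p l j * coeff_sum (v $ j)) = 0"
      using bd_tensor_chain(2)[of v A p a l] vC i l by (simp add: chain_basis_def)
  next
    fix e
    show "\<exists>l\<in>?X i. coeff_sum (v $ l) \<noteq> (\<Sum>j\<in>?X (Suc i). bd_coeff F i l j * e j)"
    proof (rule ccontr)
      assume neg: "\<not> ?thesis"
      obtain w where w: "w \<in> ?C (Suc i) a"
        and we: "\<And>j. j \<in> ?X (Suc i) \<Longrightarrow> coeff_sum (w $ j) = e j"
        using tensor_chain_exists by blast
      have "v = bd F (Suc i) *\<^sub>v w"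
      proof (rule tensor_chain_eqI[OF vC bd_tensor_chain(1)[OF w]])
        fix j assume "j \<in> ?X i"
        then show "coeff_sum (v $ j) = coeff_sum ((bd F (Suc i) *\<^sub>v w) $ j)"
          using neg we bd_tensor_chain(2)[OF w, of j] by (simp add: chain_basis_def)
      qed
      then show False using w vB by (auto simp: tensor_boundaries_def)
    qed
  qed
next
  let ?C = "tensor_chains F (ideal.span (monomial ` A))"
  let ?X = "chain_basis F (up_set A) a"
  assume nz: "strand_nonzero F i (up_set A) a"
  obtain c where cyc: "\<And>p l. i = Suc p \<Longrightarrow> l \<in> ?X p \<Longrightarrow> (\<Sum>j\<in>?X (Suc p). bd_coeff F p l j * c j) = 0"
    and nb: "\<And>e. \<exists>l\<in>?X i. c l \<noteq> (\<Sum>j\<in>?X (Suc i). bd_coeff F i l j * e j)"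
    using homology_nonzeroE[OF nz] by blast
  obtain v where v: "v \<in> ?C i a" and vc: "\<And>j. j \<in> ?X i \<Longrightarrow> coeff_sum (v $ j) = c j"
    using tensor_chain_exists by blast
  have "bd F i *\<^sub>v v = 0\<^sub>v (dim_row (bd F i))"
  proof (cases i)
    case 0
    then show ?thesis using bd_carrier_0 by auto
  next
    case (Suc p)
    have "bd F (Suc p) *\<^sub>v v = 0\<^sub>v (rk F p)"
    proof (rule tensor_chain_eqI)
      show "bd F (Suc p) *\<^sub>v v \<in> ?C p a" using bd_tensor_chain(1) v Suc by blast
      show "0\<^sub>v (rk F p) \<in> ?C p a" by (simp add: tensor_chains_iff)
      fix l assume l: "l \<in> ?X p"
      then show "coeff_sum ((bd F (Suc p) *\<^sub>v v) $ l) = coeff_sum (0\<^sub>v (rk F p) $ l)"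
        using bd_tensor_chain(2)[of v A p a l] v Suc cyc[OF Suc l] vc
        by (simp add: chain_basis_def)
    qed
    then show ?thesis using Suc by simp
  qed
  then have "v \<in> ?Z" using v by (simp add: tensor_cycles_def)
  moreover have "v \<notin> ?B"
  proof
    assume "v \<in> ?B"
    then obtain w where w: "w \<in> ?C (Suc i) a" and vw: "v = bd F (Suc i) *\<^sub>v w"
      by (auto simp: tensor_boundaries_def)
    obtain l where l: "l \<in> ?X i"
      and ne: "c l \<noteq> (\<Sum>j\<in>?X (Suc i). bd_coeff F i l j * coeff_sum (w $ j))"
      using nb[of "\<lambda>j. coeff_sum (w $ j)"] by blast
    have "l < rk F i" using l by (simp add: chain_basis_def)
    then have "coeff_sum (v $ l) = (\<Sum>j\<in>?X (Suc i). bd_coeff F i l j * coeff_sum (w $ j))"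
      using bd_tensor_chain(2)[OF w] unfolding vw by blast
    then show False using ne vc[OF l] by simp
  qed
  ultimately show "?Z \<noteq> ?B" by blast
qed

end

section \<open>Koszul homology of quotients by variables\<close>

lemma span_monomial_zero: "ideal.span (monomial ` {0}) = (UNIV :: ('n, 'k::comm_ring_1) polyring set)"
  by (intro Set.set_eqI, subst mem_span_monomials) simp

lemma convex_up_set: "convex_exponents (up_set A)"
  unfolding convex_exponents_def up_set_def by (blast intro: order_trans)

lemma up_set_upward: "b \<in> up_set A \<Longrightarrow> \<forall>s. b s \<le> c s \<Longrightarrow> c \<in> up_set A"
  unfolding up_set_def by (blast intro: order_trans)

text \<open>The exponents of the monomials outside the ideal generated by the variables in
  \<open>T\<close>; the strands compute \<open>Tor\<close> of \<open>K\<close> with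
  \<open>S/(x_s : s in T)\<close>.\<close>

definition face_exponents :: "'n set \<Rightarrow> ('n \<Rightarrow> int) set" where
  "face_exponents T = {b. (\<forall>s. 0 \<le> b s) \<and> (\<forall>s\<in>T. b s = 0)}"

lemma convex_face_exponents: "convex_exponents (face_exponents T)"
  unfolding convex_exponents_def face_exponents_def
proof (clarsimp, intro conjI allI ballI)
  fix b d c :: "'a \<Rightarrow> int" and s
  assume *: "\<forall>s. 0 \<le> b s" "\<forall>s. b s \<le> c s" "\<forall>s. c s \<le> d s" "\<forall>s\<in>T. d s = 0"
  show "0 \<le> c s" using * order_trans by blast
  show "c s = 0" if "s \<in> T" using * that by (metis order_antisym order_trans)
qed

lemma face_exponents_empty: "face_exponents {} = up_set {0}"
  by (auto simp: face_exponents_def up_set_def)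

locale residue_field_resolution =
  fixes F :: "('n::finite, 'k::field) free_complex"
  assumes resolves: "resolves_residue_field F"

sublocale residue_field_resolution \<subseteq> graded_complex
  using resolves by unfold_locales (simp add: resolves_residue_field_def)

context residue_field_resolution
begin

text \<open>Exactness in \<open>resolves_residue_field\<close> yields only some preimage
  \<open>w\<close>. The matrix entries are homogeneous, so projecting each entry of \<open>w\<close>
  to its proper multidegree leaves the image unchanged.\<close>

lemma homogeneous_boundary:
  assumes v: "v \<in> tensor_chains F UNIV p a"
    and w: "w \<in> carrier_vec (rk F (Suc p))" and vw: "v = bd F (Suc p) *\<^sub>v w"
  shows "v \<in> tensor_boundaries F UNIV p a"
proof -
  define w' where
    "w' = vec (rk F (Suc p)) (\<lambda>j. homogeneous_part (\<lambda>s. a s - mdeg F (Suc p) j s) (w $ j))"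
  have w'c: "w' \<in> carrier_vec (rk F (Suc p))" by (simp add: w'_def)
  have "v = bd F (Suc p) *\<^sub>v w'"
  proof (rule eq_vecI)
    show dim: "dim_vec v = dim_vec (bd F (Suc p) *\<^sub>v w')" using vw by simp
    fix l assume "l < dim_vec (bd F (Suc p) *\<^sub>v w')"
    then have l: "l < rk F p" by simp
    have "(bd F (Suc p) *\<^sub>v w') $ l = (\<Sum>j<rk F (Suc p). bd F (Suc p) $$ (l, j) * w' $ j)"
      by (rule bd_index[OF l w'c])
    also have "\<dots> = (\<Sum>j<rk F (Suc p). homogeneous_part (\<lambda>s. a s - mdeg F p l s)
        (bd F (Suc p) $$ (l, j) * w $ j))"
    proof (rule sum.cong[OF refl])
      fix j assume "j \<in> {..<rk F (Suc p)}"
      then have j: "j < rk F (Suc p)" by simp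
      show "bd F (Suc p) $$ (l, j) * w' $ j
          = homogeneous_part (\<lambda>s. a s - mdeg F p l s) (bd F (Suc p) $$ (l, j) * w $ j)"
        using homogeneous_part_mult[OF bd_homogeneous[OF l j],
            of "\<lambda>s. a s - mdeg F (Suc p) j s" "w $ j"] j
        by (simp add: w'_def)
    qed
    also have "\<dots> = homogeneous_part (\<lambda>s. a s - mdeg F p l s) (v $ l)"
      unfolding vw bd_index[OF l w] homogeneous_part_sum ..
    also have "\<dots> = v $ l"
      using v l by (intro homogeneous_part_id) (simp add: tensor_chains_def)
    finally show "v $ l = (bd F (Suc p) *\<^sub>v w') $ l" ..
  qed
  moreover have "w' \<in> tensor_chains F UNIV (Suc p) a"
    by (simp add: tensor_chains_def w'_def homogeneous_part_homogeneous)
  ultimately show ?thesis by (auto simp: tensor_boundaries_def)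
qed

text \<open>This is \<open>Tor\<close> of \<open>K\<close> with \<open>S\<close>, that is, the
  homology of \<open>F\<close> itself, and \<open>F\<close> resolves \<open>K\<close> placed in
  multidegree 0.\<close>

lemma strand_nonzero_nonneg: "strand_nonzero F i (up_set {0}) a \<longleftrightarrow> i = 0 \<and> a = (\<lambda>s. 0)"
proof -
  obtain \<epsilon> :: "nat \<Rightarrow> 'k" where eps0: "\<And>j. j < rk F 0 \<Longrightarrow> \<epsilon> j \<noteq> 0 \<Longrightarrow> mdeg F 0 j = (\<lambda>s. 0)"
    and eps: "\<exists>j<rk F 0. \<epsilon> j \<noteq> 0"
    and ker0: "{v \<in> carrier_vec (rk F 0). (\<Sum>j<rk F 0. Poly_Mapping.lookup (v $ j) 0 * \<epsilon> j) = 0}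
          = (\<lambda>w. bd F 1 *\<^sub>v w) ` carrier_vec (rk F 1)"
    and ker: "\<And>i. 1 \<le> i \<Longrightarrow> {v \<in> carrier_vec (rk F i). bd F i *\<^sub>v v = 0\<^sub>v (dim_row (bd F i))}
              = (\<lambda>w. bd F (Suc i) *\<^sub>v w) ` carrier_vec (rk F (Suc i))"
    using resolves unfolding resolves_residue_field_def by blast
  have *: "strand_nonzero F i (up_set {0}) a \<longleftrightarrow> tensor_cycles F UNIV i a \<noteq> tensor_boundaries F UNIV i a"
    and sub: "tensor_boundaries F UNIV i a \<subseteq> tensor_cycles F UNIV i a" for i a
    using tensor_cycles_neq_boundaries_iff[of "{0}"] tensor_boundaries_subset[of "{0}"]
    unfolding span_monomial_zero by simp_all
  have pos: "tensor_cycles F UNIV i a = tensor_boundaries F UNIV i a" if i: "1 \<le> i" for i a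
  proof (intro equalityI subsetI)
    fix v assume v: "v \<in> tensor_cycles F UNIV i a"
    then have "v \<in> {v \<in> carrier_vec (rk F i). bd F i *\<^sub>v v = 0\<^sub>v (dim_row (bd F i))}"
      by (simp add: tensor_cycles_def tensor_chains_def)
    then obtain w where "w \<in> carrier_vec (rk F (Suc i))" "v = bd F (Suc i) *\<^sub>v w"
      unfolding ker[OF i] by blast
    then show "v \<in> tensor_boundaries F UNIV i a"
      using v homogeneous_boundary by (simp add: tensor_cycles_def)
  qed (use sub in blast)
  have zero: "tensor_cycles F UNIV 0 a = tensor_boundaries F UNIV 0 a" if a: "a \<noteq> (\<lambda>s. 0)"
  proof (intro equalityI subsetI)
    fix v assume "v \<in> tensor_cycles F UNIV 0 a"
    then have v: "v \<in> tensor_chains F UNIV 0 a" by (simp add: tensor_cycles_def)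
    \<comment> \<open>A nonzero constant term at \<open>j\<close> means that \<open>a\<close> equals
      \<open>mdeg F 0 j\<close>, and the augmentation kills \<open>e_j\<close> unless this is 0. So
      for nonzero \<open>a\<close> every chain lies in the kernel of the augmentation.\<close>
    have "Poly_Mapping.lookup (v $ j) 0 * \<epsilon> j = 0" if j: "j < rk F 0" for j
    proof (rule ccontr)
      assume "\<not> ?thesis"
      then have "mdeg F 0 j = (\<lambda>s. 0)" and "0 \<in> Poly_Mapping.keys (v $ j)"
        using eps0[OF j] by (auto simp: in_keys_iff)
      moreover have "homogeneous (\<lambda>s. a s - mdeg F 0 j s) (v $ j)"
        using v j by (simp add: tensor_chains_def)
      ultimately have "a s = 0" for s
        unfolding homogeneous_def by (auto dest: bspec[of _ _ 0])
      then show False using a by auto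
    qed
    then have "(\<Sum>j<rk F 0. Poly_Mapping.lookup (v $ j) 0 * \<epsilon> j) = 0"
      by (intro sum.neutral) simp
    then have "v \<in> {v \<in> carrier_vec (rk F 0). (\<Sum>j<rk F 0. Poly_Mapping.lookup (v $ j) 0 * \<epsilon> j) = 0}"
      using v by (simp add: tensor_chains_def)
    then obtain w where "w \<in> carrier_vec (rk F (Suc 0))" "v = bd F (Suc 0) *\<^sub>v w"
      unfolding ker0 by auto
    then show "v \<in> tensor_boundaries F UNIV 0 a"
      using v homogeneous_boundary by blast
  qed (use sub in blast)
  have one: "tensor_cycles F UNIV 0 (\<lambda>s. 0) \<noteq> tensor_boundaries F UNIV 0 (\<lambda>s. 0)"
  proof
    assume eq: "tensor_cycles F UNIV 0 (\<lambda>s. 0) = tensor_boundaries F UNIV 0 (\<lambda>s. 0)"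
    obtain j where j: "j < rk F 0" "\<epsilon> j \<noteq> 0" using eps by blast
    \<comment> \<open>A basis vector with nonzero augmentation sits in multidegree 0, and exactness
      keeps it out of the boundaries.\<close>
    define v :: "('n, 'k) polyring vec" where "v = unit_vec (rk F 0) j"
    have "v \<in> tensor_cycles F UNIV 0 (\<lambda>s. 0)"
      using eps0[OF j] bd_carrier_0
      by (auto simp: v_def tensor_cycles_def tensor_chains_def homogeneous_def unit_vec_def)
    then obtain w where "w \<in> tensor_chains F UNIV 1 (\<lambda>s. 0)" "v = bd F 1 *\<^sub>v w"
      unfolding eq by (auto simp: tensor_boundaries_def)
    then have "v \<in> (\<lambda>w. bd F 1 *\<^sub>v w) ` carrier_vec (rk F 1)"
      by (auto simp: tensor_chains_def)
    then have "(\<Sum>l<rk F 0. Poly_Mapping.lookup (v $ l) 0 * \<epsilon> l) = 0"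
      unfolding ker0[symmetric] by simp
    moreover have "(\<Sum>l<rk F 0. Poly_Mapping.lookup (v $ l) 0 * \<epsilon> l)
        = (\<Sum>l<rk F 0. if l = j then \<epsilon> j else 0)"
      by (rule sum.cong) (auto simp: v_def unit_vec_def)
    ultimately show False using j by simp
  qed
  show ?thesis
    using * pos zero one by (cases i) auto
qed

text \<open>Induction along \<open>0 -> S/(T) -> S/(T) -> S/(T, x) -> 0\<close>, whose first map is
  multiplication by the variable \<open>x\<close> and shifts degrees. Classes of the shifted copy
  have entry 1 at \<open>x\<close>, those of the middle term entry 0, so the map between them is
  zero and the two families add up.\<close>

lemma strand_nonzero_face:
  assumes "finite T"
  shows "strand_nonzero F i (face_exponents T) a \<longleftrightarrow>
    (\<exists>R\<subseteq>T. card R = i \<and> a = (\<lambda>s. of_bool (s \<in> R)))"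
  using assms
proof (induction T arbitrary: i a)
  case empty
  then show ?case by (auto simp: face_exponents_empty strand_nonzero_nonneg)
next
  case (insert x T)
  define e :: "'n \<Rightarrow> int" where "e s = of_bool (s = x)" for s
  define W1 where "W1 = (\<lambda>b s. b s + e s) ` face_exponents T"
  have W1: "b \<in> W1 \<longleftrightarrow> (\<lambda>s. b s - e s) \<in> face_exponents T" for b
    unfolding W1_def by (rule shift_image_iff)
  have W1': "b \<in> W1 \<longleftrightarrow> b \<in> face_exponents T \<and> b x \<ge> 1" for b
    using insert.hyps unfolding W1 face_exponents_def e_def
    by (auto simp: of_bool_def split: if_splits)
  interpret subcomplex "bd_coeff F" "chain_basis F (face_exponents T) a" "chain_basis F W1 a"
    "chain_basis F (face_exponents (insert x T)) a"
  proof (rule subcomplexI[OF convex_face_exponents])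
    have "b \<in> face_exponents (insert x T) \<longleftrightarrow> b \<in> face_exponents T \<and> \<not> b x \<ge> 1" for b
    proof -
      have "0 \<le> b x \<Longrightarrow> b x = 0 \<longleftrightarrow> \<not> b x \<ge> 1" by auto
      then show ?thesis unfolding face_exponents_def by blast
    qed
    then show "face_exponents T = W1 \<union> face_exponents (insert x T)"
      "W1 \<inter> face_exponents (insert x T) = {}"
      using W1' by blast+
    show "c \<in> W1" if "b \<in> W1" "c \<in> face_exponents T" "\<forall>s. b s \<le> c s" for b c
      using that unfolding W1' by (meson order_trans)
  qed
  have nz1: "strand_nonzero F p W1 a \<longleftrightarrow> (\<exists>R\<subseteq>T. card R = p \<and> a = (\<lambda>s. of_bool (s \<in> insert x R)))" for p a
  proof -
    have "strand_nonzero F p W1 a \<longleftrightarrow> (\<exists>R\<subseteq>T. card R = p \<and> (\<lambda>s. a s - e s) = (\<lambda>s. of_bool (s \<in> R)))"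
      unfolding W1_def strand_nonzero_shift insert.IH ..
    moreover have "(\<lambda>s. a s - e s) = (\<lambda>s. of_bool (s \<in> R)) \<longleftrightarrow> a = (\<lambda>s. of_bool (s \<in> insert x R))"
      if "R \<subseteq> T" for R
    proof -
      have "e s + of_bool (s \<in> R) = of_bool (s \<in> insert x R)" for s
        using that insert.hyps by (auto simp: e_def)
      then show ?thesis by (auto simp: fun_eq_iff algebra_simps)
    qed
    ultimately show ?thesis by blast
  qed
  show ?case
  proof
    assume "strand_nonzero F i (face_exponents (insert x T)) a"
    then consider "strand_nonzero F i (face_exponents T) a"
      | p where "i = Suc p" "strand_nonzero F p W1 a"
      using exact_quotient by blast
    then show "\<exists>R\<subseteq>insert x T. card R = i \<and> a = (\<lambda>s. of_bool (s \<in> R))"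
    proof cases
      case 1
      then show ?thesis unfolding insert.IH by blast
    next
      case 2
      then obtain R where R: "R \<subseteq> T" "card R = p" "a = (\<lambda>s. of_bool (s \<in> insert x R))"
        unfolding nz1 by blast
      have "card (insert x R) = i"
        using R insert.hyps 2(1) finite_subset[of R T] by (subst card_insert_disjoint) auto
      then show ?thesis using R by (intro exI[of _ "insert x R"]) auto
    qed
  next
    assume "\<exists>R\<subseteq>insert x T. card R = i \<and> a = (\<lambda>s. of_bool (s \<in> R))"
    then obtain R where R: "R \<subseteq> insert x T" "card R = i" and a: "a = (\<lambda>s. of_bool (s \<in> R))" by blast
    show "strand_nonzero F i (face_exponents (insert x T)) a"
    proof (cases "x \<in> R")
      case False
      then have "strand_nonzero F i (face_exponents T) a"
        using R a unfolding insert.IH by (intro exI[of _ R]) auto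
      moreover have "\<not> strand_nonzero F i W1 a"
      proof
        assume "strand_nonzero F i W1 a"
        then obtain R' where "a = (\<lambda>s. of_bool (s \<in> insert x R'))" unfolding nz1 by blast
        then have "(of_bool (x \<in> R) :: int) = of_bool (x \<in> insert x R')" unfolding a by (rule fun_cong)
        then show False using False by simp
      qed
      ultimately show ?thesis using exact_middle by blast
    next
      case True
      have "finite R" using R(1) insert.hyps(1) finite_subset by blast
      then have i: "i = Suc (card (R - {x}))" using card_Suc_Diff1[OF \<open>finite R\<close> True] R(2) by simp
      have "insert x (R - {x}) = R" using True by blast
      then have "strand_nonzero F (card (R - {x})) W1 a"
        using R(1) unfolding nz1 a by (intro exI[of _ "R - {x}"]) auto
      moreover have "\<not> strand_nonzero F (card (R - {x})) (face_exponents T) a"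
      proof
        assume "strand_nonzero F (card (R - {x})) (face_exponents T) a"
        then obtain R' where R': "R' \<subseteq> T" "a = (\<lambda>s. of_bool (s \<in> R'))" unfolding insert.IH by blast
        then have "(of_bool (x \<in> R) :: int) = of_bool (x \<in> R')" unfolding a by (rule_tac fun_cong)
        then show False using True R' insert.hyps by auto
      qed
      ultimately show ?thesis using exact_sub i by blast
    qed
  qed
qed

end

section \<open>Linear quotients\<close>

text \<open>The set \<open>B\<close> of exponents is ordered by \<open>R\<close> in such a way that the colon ideal of the
  generators preceding \<open>x\<close> by \<open>x\<close> is generated by the variables in \<open>\<sigma> x\<close>.\<close>

locale linear_quotients =
  fixes B :: "('n::finite \<Rightarrow>\<^sub>0 nat) set"
    and R :: "('n \<Rightarrow>\<^sub>0 nat) \<Rightarrow> ('n \<Rightarrow>\<^sub>0 nat) \<Rightarrow> bool"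
    and \<sigma> :: "('n \<Rightarrow>\<^sub>0 nat) \<Rightarrow> 'n set"
    and d :: nat
  assumes finite_B: "finite B"
    and degree: "x \<in> B \<Longrightarrow> (\<Sum>s\<in>UNIV. Poly_Mapping.lookup x s) = d"
    and trans: "transp_on B R" and asym: "asymp_on B R" and total: "totalp_on B R"
    and colon_le: "x \<in> B \<Longrightarrow> y \<in> B \<Longrightarrow> R y x \<Longrightarrow>
      \<exists>s\<in>\<sigma> x. Poly_Mapping.lookup x s < Poly_Mapping.lookup y s"
    and colon_ge: "x \<in> B \<Longrightarrow> s \<in> \<sigma> x \<Longrightarrow>
      \<exists>y\<in>B. R y x \<and> (\<forall>t. Poly_Mapping.lookup y t \<le> Poly_Mapping.lookup x t + of_bool (t = s))"
begin

definition betti_degrees :: "('n \<Rightarrow>\<^sub>0 nat) set \<Rightarrow> nat \<Rightarrow> ('n \<Rightarrow> int) set" where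
  "betti_degrees A i = {a. \<exists>x\<in>A. \<exists>T\<subseteq>\<sigma> x. card T = i \<and>
      a = (\<lambda>s. int (Poly_Mapping.lookup x s) + of_bool (s \<in> T))}"

text \<open>Total degree determines homological degree. Hence no multidegree occurs in two adjacent
  groups, and this makes the connecting maps vanish.\<close>

lemma betti_degrees_degree:
  assumes "a \<in> betti_degrees A i" "A \<subseteq> B"
  shows "(\<Sum>s\<in>UNIV. a s) = int (d + i)"
proof -
  obtain x T where x: "x \<in> A" "card T = i"
    and a: "a = (\<lambda>s. int (Poly_Mapping.lookup x s) + of_bool (s \<in> T))"
    using assms(1) by (auto simp: betti_degrees_def)
  have "(\<Sum>s\<in>UNIV. of_bool (s \<in> T) :: int) = int (card T)"
    by (simp add: of_bool_def sum.If_cases)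
  moreover have "(\<Sum>s\<in>UNIV. int (Poly_Mapping.lookup x s)) = int d"
    using degree[of x] x assms(2) by (auto simp flip: of_nat_sum)
  ultimately show ?thesis using x by (simp add: a sum.distrib)
qed

text \<open>Induction on initial segments of the order. If \<open>x\<close> is the last element of
  \<open>A\<close>, the ideal of \<open>A\<close> modulo the ideal of \<open>A - {x}\<close> is
  \<open>S\<close> modulo the variables in \<open>\<sigma> x\<close>, shifted by \<open>x\<close>;
  its \<open>Tor\<close> is given by \<open>strand_nonzero_face\<close>.\<close>

lemma strand_nonzero_iff:
  fixes F :: "('n, 'k::field) free_complex"
  assumes F: "resolves_residue_field F"
    and A: "A \<subseteq> B" and closed: "\<And>x y. x \<in> A \<Longrightarrow> y \<in> B \<Longrightarrow> R y x \<Longrightarrow> y \<in> A"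
  shows "strand_nonzero F i (up_set A) a \<longleftrightarrow> a \<in> betti_degrees A i"
proof -
  interpret residue_field_resolution F by unfold_locales (rule F)
  from A have "finite A" using finite_B finite_subset by blast
  then show ?thesis using A closed
  proof (induction "card A" arbitrary: A i a)
    case 0
    then have "A = {}" by simp
    then show ?case
      by (simp add: homology_nonzero_def up_set_def chain_basis_def betti_degrees_def)
  next
    case (Suc n)
    have "A \<noteq> {}" using Suc.hyps(2) by auto
    from Finite_Set.bex_max_element[OF Suc.prems(1) asymp_on_subset[OF asym Suc.prems(2)]
        transp_on_subset[OF trans Suc.prems(2)] this]
    obtain x where x: "x \<in> A" and x_max: "\<forall>y\<in>A. y \<noteq> x \<longrightarrow> \<not> R x y"
      by (rule bexE)
    define A' where "A' = A - {x}"
    have A_eq: "A = insert x A'" using x by (auto simp: A'_def)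
    have xB: "x \<in> B" using x Suc.prems by blast
    have before: "R y x" if "y \<in> A'" for y
    proof -
      have y: "y \<in> A" "y \<noteq> x" using that by (auto simp: A'_def)
      then have "R x y \<or> R y x"
        using totalp_onD[OF total, of x y] xB Suc.prems(2) by auto
      then show ?thesis using x_max y by auto
    qed
    have closed': "y \<in> A'" if "z \<in> A'" "y \<in> B" "R y z" for y z
      using that x_max Suc.prems(3)[of z y] by (auto simp: A'_def)
    have A'B: "A' \<subseteq> B" using Suc.prems(2) by (auto simp: A'_def)
    have IH: "strand_nonzero F i (up_set A') a \<longleftrightarrow> a \<in> betti_degrees A' i" for i a
    proof (rule Suc.hyps(1))
      show "n = card A'" "finite A'" using Suc.hyps(2) x Suc.prems(1) by (auto simp: A'_def)
    qed (fact A'B, fact closed')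
    define lx where "lx s = int (Poly_Mapping.lookup x s)" for s
    define W2 where "W2 = (\<lambda>b s. b s + lx s) ` face_exponents (\<sigma> x)"
    have W2: "b \<in> W2 \<longleftrightarrow> (\<forall>s. lx s \<le> b s) \<and> (\<forall>s\<in>\<sigma> x. b s = lx s)" for b
      unfolding W2_def shift_image_iff face_exponents_def by simp
    have un: "up_set A = up_set A' \<union> W2"
    proof (intro equalityI subsetI)
      fix b assume b: "b \<in> up_set A"
      show "b \<in> up_set A' \<union> W2"
      proof (cases "b \<in> up_set A'")
        case False
        then have bx: "\<forall>s. lx s \<le> b s" using b unfolding A_eq up_set_def lx_def by blast
        \<comment> \<open>If \<open>b\<close> exceeded \<open>x\<close> at such an \<open>s\<close>,
          the earlier generator supplied by \<open>colon_ge\<close> would divide, putting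
          \<open>b\<close> into \<open>up_set A'\<close>.\<close>
        have "b s = lx s" if s: "s \<in> \<sigma> x" for s
        proof (rule ccontr)
          assume "b s \<noteq> lx s"
          then have bs: "b s \<ge> lx s + 1" using bx[rule_format, of s] by linarith
          obtain y where y: "y \<in> B" "R y x"
            "\<forall>t. Poly_Mapping.lookup y t \<le> Poly_Mapping.lookup x t + of_bool (t = s)"
            using colon_ge[OF xB s] by blast
          have "y \<noteq> x" using y(2) asym xB by (auto simp: asymp_on_def)
          then have "y \<in> A'" using Suc.prems(3)[OF x y(1,2)] by (simp add: A'_def)
          moreover have "int (Poly_Mapping.lookup y t) \<le> b t" for t
            using y(3)[rule_format, of t] bs bx[rule_format, of t]
            by (cases "t = s") (auto simp: lx_def)
          ultimately show False using False by (auto simp: up_set_def)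
        qed
        then show ?thesis using bx W2 by blast
      qed simp
    next
      fix b assume "b \<in> up_set A' \<union> W2"
      then show "b \<in> up_set A" unfolding Un_iff W2 unfolding A_eq up_set_def lx_def by blast
    qed
    have disj: "up_set A' \<inter> W2 = {}"
    proof (rule ccontr)
      assume "\<not> ?thesis"
      then obtain b y where b: "b \<in> W2" and y: "y \<in> A'" "\<forall>s. int (Poly_Mapping.lookup y s) \<le> b s"
        by (auto simp: up_set_def)
      obtain s where "s \<in> \<sigma> x" "Poly_Mapping.lookup x s < Poly_Mapping.lookup y s"
        using colon_le[OF xB _ before[OF y(1)]] y(1) A'B by blast
      then show False using b y(2)[rule_format, of s] unfolding W2 lx_def by auto
    qed
    interpret subcomplex "bd_coeff F" "chain_basis F (up_set A) a" "chain_basis F (up_set A') a"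
      "chain_basis F W2 a"
      by (rule subcomplexI[OF convex_up_set un disj]) (rule up_set_upward)
    have betti_x: "strand_nonzero F i W2 a \<longleftrightarrow> a \<in> betti_degrees {x} i" for i a
    proof -
      have "(\<lambda>s. a s - lx s) = (\<lambda>s. of_bool (s \<in> T)) \<longleftrightarrow> a = (\<lambda>s. lx s + of_bool (s \<in> T))" for T
        by (auto simp: fun_eq_iff algebra_simps)
      then show ?thesis
        unfolding W2_def strand_nonzero_shift strand_nonzero_face[OF finite] betti_degrees_def lx_def
        by simp
    qed
    have split: "betti_degrees A i = betti_degrees A' i \<union> betti_degrees {x} i" for i
      unfolding A_eq betti_degrees_def by blast
    have deg: "i = j" if "a \<in> betti_degrees A i" "a \<in> betti_degrees A j" for i j
      using betti_degrees_degree[OF that(1)] betti_degrees_degree[OF that(2)] Suc.prems(2) by simp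
    show ?case
    proof
      assume "strand_nonzero F i (up_set A) a"
      then show "a \<in> betti_degrees A i" using exact_middle[of i] IH[of a i] betti_x[of a i] split[of i] by auto
    next
      assume "a \<in> betti_degrees A i"
      then consider "strand_nonzero F i (up_set A') a" | "strand_nonzero F i W2 a"
        using IH[of a i] betti_x[of a i] split[of i] by auto
      then show "strand_nonzero F i (up_set A) a"
      proof cases
        case 1
        have "\<not> strand_nonzero F (Suc i) W2 a"
          using 1 deg[of i "Suc i"] IH betti_x split by auto
        then show ?thesis using exact_sub[of i] 1 by simp
      next
        case 2
        have "\<not> strand_nonzero F p (up_set A') a" if "i = Suc p" for p
          using 2 deg[of i p] that IH betti_x split by auto
        then show ?thesis using exact_quotient[of i] 2 by auto
      qed
    qed
  qed
qed

text \<open>\<open>Tor_nonzero\<close> asks for some resolution, and by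
  \<open>strand_nonzero_iff\<close> every resolution gives the same answer; whether one exists
  remains as an explicit conjunct.\<close>

lemma Tor_nonzero_iff:
  "Tor_nonzero i (ideal.span (monomial ` B) :: ('n, 'k::field) polyring set) a \<longleftrightarrow>
     (\<exists>F :: ('n, 'k) free_complex. resolves_residue_field F) \<and> a \<in> betti_degrees B i"
proof -
  have "tensor_cycles F (ideal.span (monomial ` B)) i a \<noteq> tensor_boundaries F (ideal.span (monomial ` B)) i a
      \<longleftrightarrow> a \<in> betti_degrees B i" if F: "resolves_residue_field F" for F :: "('n, 'k) free_complex"
  proof -
    interpret residue_field_resolution F by unfold_locales (rule F)
    show ?thesis
      unfolding tensor_cycles_neq_boundaries_iff by (rule strand_nonzero_iff[OF F]) auto
  qed
  then show ?thesis unfolding Tor_nonzero_def by blast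
qed

end

section \<open>Complete multipartite graphs\<close>

text \<open>In the application \<open>V\<close> consists of the vertices of positive degree and
  \<open>col\<close> names the part of a vertex.\<close>

locale coloured_vertices =
  fixes V :: "'n::finite set" and col :: "'n \<Rightarrow> 'c"
begin

definition weight :: "('n \<Rightarrow> nat) \<Rightarrow> 'c \<Rightarrow> nat" where
  "weight u p = (\<Sum>s | col s = p. u s)"

definition colour_supp :: "('n \<Rightarrow> nat) \<Rightarrow> 'c \<Rightarrow> 'n set" where
  "colour_supp u p = {s. col s = p \<and> u s \<noteq> 0}"

definition edge_vector :: "'n \<Rightarrow> 'n \<Rightarrow> 'n \<Rightarrow> nat" where
  "edge_vector s t = (\<lambda>x. of_bool (x = s) + of_bool (x = t))"

definition edge_vectors :: "('n \<Rightarrow> nat) set" where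
  "edge_vectors = {edge_vector s t | s t. s \<in> V \<and> t \<in> V \<and> col s \<noteq> col t}"

definition power_gens :: "nat \<Rightarrow> ('n \<Rightarrow> nat) set" where
  "power_gens k = {u. {s. u s \<noteq> 0} \<subseteq> V \<and> sum u UNIV = 2 * k \<and> (\<forall>p. weight u p \<le> k)}"

text \<open>\<open>shift_gens k i\<close> describes the exponents \<open>a\<close> of degree \<open>2k + i\<close> for which the sets \<open>T\<close> with
  \<open>a - 1\<^sub>T \<in> power_gens k\<close> are the bases of a matroid without coloops: such a \<open>T\<close> has at least
  \<open>weight a p - k\<close> elements of colour \<open>p\<close>, and must be able to avoid any given vertex.\<close>

definition shift_gens :: "nat \<Rightarrow> nat \<Rightarrow> ('n \<Rightarrow> nat) set" where
  "shift_gens k i = {a. {s. a s \<noteq> 0} \<subseteq> V \<and> sum a UNIV = 2 * k + i \<and> i < card {s. a s \<noteq> 0} \<and>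
     (\<forall>p. weight a p \<le> k + i \<and> weight a p < k + card (colour_supp a p))}"

text \<open>The sum runs over the colours of the support because the type of colours need not be
  finite.\<close>

lemma sum_weight: "(\<Sum>p\<in>col ` {s. u s \<noteq> 0}. weight u p) = sum u UNIV"
proof -
  have "sum u {s. u s \<noteq> 0} = (\<Sum>p\<in>col ` {s. u s \<noteq> 0}. sum u {s. s \<in> {s. u s \<noteq> 0} \<and> col s = p})"
    by (rule sum.image_gen) simp
  also have "\<dots> = (\<Sum>p\<in>col ` {s. u s \<noteq> 0}. weight u p)"
    unfolding weight_def by (intro sum.cong refl sum.mono_neutral_left) auto
  also have "sum u {s. u s \<noteq> 0} = sum u UNIV"
    by (intro sum.mono_neutral_left) auto
  finally show ?thesis ..
qed

lemma weight_eq_0_iff: "weight u p = 0 \<longleftrightarrow> p \<notin> col ` {s. u s \<noteq> 0}"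
  unfolding weight_def by (subst sum_eq_0_iff) auto

lemma heavy_subset:
  assumes "\<And>p. p \<in> X \<Longrightarrow> m \<le> weight u p" "0 < m"
  shows "X \<subseteq> col ` {s. u s \<noteq> 0}"
proof
  fix p assume "p \<in> X"
  then show "p \<in> col ` {s. u s \<noteq> 0}" using assms(1)[of p] assms(2) weight_eq_0_iff[of u p] by linarith
qed

lemma sum_weight_le: "finite P \<Longrightarrow> (\<Sum>p\<in>P. weight u p) \<le> sum u UNIV"
proof -
  assume P: "finite P"
  have "(\<Sum>p\<in>P. weight u p) = (\<Sum>p\<in>P \<inter> col ` {s. u s \<noteq> 0}. weight u p)"
    using P weight_eq_0_iff by (intro sum.mono_neutral_right) auto
  also have "\<dots> \<le> (\<Sum>p\<in>col ` {s. u s \<noteq> 0}. weight u p)"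
    by (intro sum_mono2) auto
  finally show ?thesis unfolding sum_weight .
qed

text \<open>Counting: \<open>c + 1\<close> heavy colours would already use up total degree
  \<open>(c + 1) * m\<close>.\<close>

lemma card_heavy_le:
  assumes X: "\<And>p. p \<in> X \<Longrightarrow> m \<le> weight u p" and m: "0 < m" "sum u UNIV < (c + 1) * m"
  shows "finite X" "card X \<le> c"
proof -
  have "X \<subseteq> col ` {s. u s \<noteq> 0}"
    using X m(1) by (rule heavy_subset)
  then show fin: "finite X" by (rule finite_subset) simp
  have "card X * m \<le> (\<Sum>p\<in>X. weight u p)"
    using sum_bounded_below[of X m "weight u"] X by simp
  then have "card X * m < (c + 1) * m"
    using sum_weight_le[OF fin, of u] m(2) by linarith
  then have "card X < c + 1" unfolding mult_less_cancel2 ..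
  then show "card X \<le> c" by simp
qed

lemma two_colours:
  assumes "\<And>p. weight u p < sum u UNIV"
  shows "2 \<le> card (col ` {s. u s \<noteq> 0})"
proof (rule ccontr)
  assume "\<not> ?thesis"
  then consider "card (col ` {s. u s \<noteq> 0}) = 0" | "card (col ` {s. u s \<noteq> 0}) = 1" by linarith
  then show False
  proof cases
    case 1
    then have "col ` {s. u s \<noteq> 0} = {}" by simp
    then show False using sum_weight[of u] assms by simp
  next
    case 2
    then obtain p where "col ` {s. u s \<noteq> 0} = {p}" using card_1_singletonE by blast
    then show False using sum_weight[of u] assms[of p] by simp
  qed
qed

text \<open>Supplies the colours of the edge to be removed: the at most two extremal colours in
  \<open>X\<close>, completed to a pair from the available colours \<open>Y\<close>.\<close>

lemma between_two:
  assumes "X \<subseteq> Y" "finite X" "card X \<le> 2" "finite Y" "2 \<le> card Y"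
  shows "\<exists>p\<in>Y. \<exists>q\<in>Y. p \<noteq> q \<and> X \<subseteq> {p, q}"
proof -
  obtain Z where Z: "X \<subseteq> Z" "Z \<subseteq> Y" "card Z = 2"
    using exists_subset_between[of X 2 Y] assms by auto
  then obtain p q where "Z = {p, q}" "p \<noteq> q" unfolding card_2_iff by blast
  then show ?thesis using Z by blast
qed

lemma
  assumes u: "u = (\<lambda>x. edge_vector s t x + v x)"
  shows sum_add_edge: "sum u UNIV = sum v UNIV + 2"
    and weight_add_edge: "weight u p = weight v p + of_bool (col s = p) + of_bool (col t = p)"
proof -
  have *: "(\<Sum>x\<in>A. of_bool (x = s) :: nat) = of_bool (s \<in> A)" if "finite A" for A and s :: 'n
    using that by (simp add: of_bool_def)
  show "sum u UNIV = sum v UNIV + 2"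
    unfolding u edge_vector_def by (simp add: sum.distrib *)
  show "weight u p = weight v p + of_bool (col s = p) + of_bool (col t = p)"
    unfolding u edge_vector_def weight_def by (simp add: sum.distrib *)
qed

section \<open>Splitting off an edge\<close>

lemma remove_edge:
  assumes "u s \<noteq> 0" "u t \<noteq> 0" "s \<noteq> t"
  obtains v where "u = (\<lambda>x. edge_vector s t x + v x)"
proof
  show "u = (\<lambda>x. edge_vector s t x + (u x - edge_vector s t x))"
    using assms by (auto simp: edge_vector_def fun_eq_iff)
qed

lemma power_gens_0: "power_gens 0 = {\<lambda>s. 0}"
  by (auto simp: power_gens_def weight_def fun_eq_iff)

text \<open>The edge to split off has to meet every part of weight \<open>Suc k\<close>. Total
  degree \<open>2 * Suc k\<close> leaves room for at most two of them, and since no part carries the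
  whole degree, two parts are available for the ends.\<close>

lemma power_gens_Suc: "power_gens (Suc k) = {\<lambda>x. e x + v x | e v. e \<in> edge_vectors \<and> v \<in> power_gens k}"
proof (intro equalityI subsetI)
  fix u assume u: "u \<in> power_gens (Suc k)"
  then have V: "{s. u s \<noteq> 0} \<subseteq> V" and tot: "sum u UNIV = 2 * Suc k" and w: "\<And>p. weight u p \<le> Suc k"
    by (auto simp: power_gens_def)
  define X where "X = {p. weight u p = Suc k}"
  have X: "X \<subseteq> col ` {s. u s \<noteq> 0}"
    by (rule heavy_subset[of _ "Suc k"]) (simp_all add: X_def)
  have X2: "finite X" "card X \<le> 2"
    using card_heavy_le[of X "Suc k" u 2] tot by (auto simp: X_def)
  have "2 \<le> card (col ` {s. u s \<noteq> 0})"
  proof (rule two_colours)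
    show "weight u p < sum u UNIV" for p using w[of p] tot by simp
  qed
  from between_two[OF X X2 _ this] obtain p q
    where pq: "p \<noteq> q" "p \<in> col ` {s. u s \<noteq> 0}" "q \<in> col ` {s. u s \<noteq> 0}" "X \<subseteq> {p, q}"
    by auto
  then obtain s t where st: "u s \<noteq> 0" "u t \<noteq> 0" "col s = p" "col t = q" by blast
  moreover from this have "s \<noteq> t" using pq by auto
  ultimately obtain v where v: "u = (\<lambda>x. edge_vector s t x + v x)" using remove_edge by blast
  have "weight v r \<le> k" for r
    using weight_add_edge[OF v, of r] w[of r] st pq by (cases "r \<in> X") (auto simp: X_def split: if_splits)
  moreover have "{s. v s \<noteq> 0} \<subseteq> V" using V v by auto
  ultimately have "v \<in> power_gens k"
    using sum_add_edge[OF v] tot by (simp add: power_gens_def)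
  moreover have "edge_vector s t \<in> edge_vectors"
    using st pq V unfolding edge_vectors_def by blast
  ultimately show "u \<in> {\<lambda>x. e x + v x | e v. e \<in> edge_vectors \<and> v \<in> power_gens k}"
    using v by blast
next
  fix u assume "u \<in> {\<lambda>x. e x + v x | e v. e \<in> edge_vectors \<and> v \<in> power_gens k}"
  then obtain s t v where u: "u = (\<lambda>x. edge_vector s t x + v x)"
    and st: "s \<in> V" "t \<in> V" "col s \<noteq> col t" and v: "v \<in> power_gens k"
    by (auto simp: edge_vectors_def)
  have "{x. u x \<noteq> 0} \<subseteq> insert s (insert t {x. v x \<noteq> 0})"
    by (auto simp: u edge_vector_def)
  then have "{x. u x \<noteq> 0} \<subseteq> V" using st v by (auto simp: power_gens_def)
  moreover have "weight u p \<le> Suc k" for p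
  proof -
    have "weight v p \<le> k" using v by (simp add: power_gens_def)
    then show ?thesis using weight_add_edge[OF u, of p] st by auto
  qed
  ultimately show "u \<in> power_gens (Suc k)"
    using sum_add_edge[OF u] v by (simp add: power_gens_def)
qed

text \<open>Adding an edge raises each weight by at most one and shrinks no support, which settles
  one inclusion. For the other, the removed edge must lower every extremal weight, while neither the
  whole support nor the support in a part may become too small.\<close>

lemma shift_gens_Suc:
  assumes i: "1 \<le> i" and ik: "i \<le> k"
  shows "shift_gens (Suc k) i = {\<lambda>x. e x + v x | e v. e \<in> edge_vectors \<and> v \<in> shift_gens k i}"
proof (intro equalityI subsetI)
  fix u assume u: "u \<in> shift_gens (Suc k) i"
  define S where "S = {s. u s \<noteq> 0}"
  define n where "n p = card (colour_supp u p)" for p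
  have V: "S \<subseteq> V" and tot: "sum u UNIV = 2 * k + 2 + i" and supp: "i < card S"
    and w1: "\<And>p. weight u p \<le> k + 1 + i" and w2: "\<And>p. weight u p \<le> k + n p"
    using u by (auto simp: shift_gens_def S_def n_def less_Suc_eq_le)
  \<comment> \<open>The strict bound for \<open>Suc k\<close> was rewritten as the weak bound
    \<open>w2\<close>, so equality in either clause marks a part that violates a bound of
    \<open>shift_gens k i\<close>.\<close>
  define X where "X = {p. weight u p = k + 1 + i \<or> weight u p = k + n p}"
  \<comment> \<open>Parts with an exponent of at least 2, from which a unit can be taken without
    changing the support. In every other part, weight and size of the support agree
    (\<open>ones\<close>).\<close>
  define D where "D = col ` {s. 2 \<le> u s}"
  have ones: "weight u p = n p" if "p \<notin> D" for p
  proof -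
    have "weight u p = (\<Sum>s | col s = p. of_bool (u s \<noteq> 0))"
      unfolding weight_def
    proof (rule sum.cong[OF refl])
      fix s assume "s \<in> {s. col s = p}"
      then have "\<not> 2 \<le> u s" using that by (auto simp: D_def)
      then show "u s = of_bool (u s \<noteq> 0)" by auto
    qed
    then show ?thesis by (simp add: n_def colour_supp_def of_bool_def sum.If_cases Int_def)
  qed
  have finD: "finite D" by (simp add: D_def)
  have finS: "finite (col ` S)" by simp
  have DS: "D \<subseteq> col ` S" by (auto simp: D_def S_def)
  have X_heavy: "k + 1 \<le> weight u p" if "p \<in> X" for p
  proof (rule ccontr)
    assume *: "\<not> ?thesis"
    \<comment> \<open>Weight at most \<open>k\<close> leaves only the second clause of
      \<open>X\<close>, with \<open>n p = 0\<close>: a part with empty support but positive weight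
      \<open>k\<close>.\<close>
    then have "n p = 0" "weight u p = k" using that w2[of p] by (auto simp: X_def)
    then show False
      using i ik weight_eq_0_iff[of u p] unfolding n_def colour_supp_def by auto
  qed
  have XS: "X \<subseteq> col ` S"
    unfolding S_def by (rule heavy_subset[OF X_heavy]) simp_all
  \<comment> \<open>Here \<open>i \<le> k\<close> enters:
    \<open>2 * k + 2 + i < 3 * (k + 1)\<close>.\<close>
  have X2: "finite X" "card X \<le> 2"
    using card_heavy_le[of X "k + 1" u 2] X_heavy tot ik by auto
  have n_le: "n p \<le> card S" for p
    unfolding n_def colour_supp_def S_def by (intro card_mono) auto
  have S2: "2 \<le> card (col ` S)"
    unfolding S_def
  proof (rule two_colours)
    show "weight u p < sum u UNIV" for p using w1[of p] tot by simp
  qed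
  \<comment> \<open>Only parts in \<open>X\<close> are too heavy for \<open>shift_gens k i\<close>, so the edge to be removed has to meet
    them. Taking its ends in \<open>D\<close> keeps the support; when this is impossible, the support is so
    large that it may shrink.\<close>
  have light: "i + 3 \<le> card S \<or> X \<subseteq> D \<and> 2 \<le> card D"
  proof (rule ccontr)
    assume neg: "\<not> ?thesis"
    have "X \<subseteq> D"
    proof
      fix p assume p: "p \<in> X"
      show "p \<in> D"
      proof (rule ccontr)
        assume "p \<notin> D"
        \<comment> \<open>Outside \<open>D\<close> the weight is \<open>n p\<close>, so for positive
          \<open>k\<close> only the first clause of \<open>X\<close> is possible. As a second part
          is occupied, the support has at least \<open>k + i + 2\<close>, hence
          \<open>i + 3\<close>, elements.\<close>
        then have "n p = k + 1 + i" using ones[of p] p i ik by (auto simp: X_def)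
        moreover have "n p < card S"
        proof -
          have "\<not> S \<subseteq> colour_supp u p"
          proof
            assume "S \<subseteq> colour_supp u p"
            then have "col ` S \<subseteq> {p}" by (auto simp: colour_supp_def)
            then have "card (col ` S) \<le> 1" using card_mono[of "{p}" "col ` S"] by simp
            then show False using S2 by simp
          qed
          then have "colour_supp u p \<subset> S" by (auto simp: colour_supp_def S_def)
          then show ?thesis unfolding n_def by (intro psubset_card_mono) auto
        qed
        ultimately show False using neg i ik by linarith
      qed
    qed
    then have D1: "card D \<le> 1" using neg by linarith
    have "\<exists>p. D \<subseteq> {p}"
    proof (cases "D = {}")
      case False
      then have "card D = 1" using D1 by (simp add: D_def Suc_leI card_gt_0_iff le_antisym)
      then show ?thesis using card_1_singletonE by blast
    qed auto
    then obtain p where p: "D \<subseteq> {p}" by blast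
    have "card S = (\<Sum>q\<in>col ` S. n q)"
    proof -
      have "card S = (\<Sum>q\<in>col ` S. card {s. s \<in> S \<and> col s = q})"
        using sum.image_gen[of S "\<lambda>_. 1 :: nat" col] by simp
      moreover have "{s. s \<in> S \<and> col s = q} = colour_supp u q" for q
        by (auto simp: colour_supp_def S_def)
      ultimately show ?thesis by (simp add: n_def)
    qed
    \<comment> \<open>Only \<open>p\<close> can have weight above the size of its support, and by at
      most \<open>k\<close>. With total degree \<open>2 * k + 2 + i\<close> this again makes the
      support at least \<open>k + i + 2\<close>.\<close>
    then have "card S + k \<ge> (\<Sum>q\<in>col ` S. weight u q)"
    proof (cases "p \<in> col ` S")
      case True
      have "(\<Sum>q\<in>col ` S. weight u q) = weight u p + (\<Sum>q\<in>col ` S - {p}. weight u q)"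
        using True by (intro sum.remove) auto
      also have "(\<Sum>q\<in>col ` S - {p}. weight u q) = (\<Sum>q\<in>col ` S - {p}. n q)"
        using ones p by (intro sum.cong) auto
      also have "weight u p \<le> k + n p" by (rule w2)
      also have "k + n p + (\<Sum>q\<in>col ` S - {p}. n q) = k + (\<Sum>q\<in>col ` S. n q)"
        using True by (simp add: sum.remove[of "col ` S" p])
      finally show ?thesis using \<open>card S = _\<close> by simp
    next
      case False
      have "(\<Sum>q\<in>col ` S. weight u q) = (\<Sum>q\<in>col ` S. n q)"
        using ones p False by (intro sum.cong) auto
      then show ?thesis using \<open>card S = _\<close> by simp
    qed
    then have "2 * k + 2 + i \<le> card S + k"
      using sum_weight[of u] tot by (simp add: S_def)
    then show False using neg i ik by linarith
  qed
  \<comment> \<open>The constant \<open>i + 3\<close> is chosen such that more than \<open>i\<close>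
    vertices remain when both ends leave the support. An end in a part of \<open>D\<close> is taken
    at an exponent of at least 2, so that the support of this part is kept.\<close>
  have "\<exists>s t. u s \<noteq> 0 \<and> u t \<noteq> 0 \<and> col s \<noteq> col t \<and> X \<subseteq> {col s, col t} \<and>
      (col s \<in> D \<longrightarrow> 2 \<le> u s) \<and> (col t \<in> D \<longrightarrow> 2 \<le> u t) \<and>
      (i + 3 \<le> card S \<or> 2 \<le> u s \<and> 2 \<le> u t)"
  proof -
    have pick: "\<exists>s. u s \<noteq> 0 \<and> col s = p \<and> (p \<in> D \<longrightarrow> 2 \<le> u s)" if "p \<in> col ` S" for p
    proof (cases "p \<in> D")
      case True
      then obtain s where "2 \<le> u s" "col s = p" by (auto simp: D_def)
      then show ?thesis by (intro exI[of _ s]) auto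
    qed (use that in \<open>auto simp: S_def\<close>)
    show ?thesis
    proof (cases "i + 3 \<le> card S")
      case True
      obtain p q where pq: "p \<noteq> q" "p \<in> col ` S" "q \<in> col ` S" "X \<subseteq> {p, q}"
        using between_two[OF XS X2 _ S2] finS by blast
      obtain s where "u s \<noteq> 0" "col s = p" "p \<in> D \<longrightarrow> 2 \<le> u s" using pick[OF pq(2)] by blast
      moreover obtain t where "u t \<noteq> 0" "col t = q" "q \<in> D \<longrightarrow> 2 \<le> u t" using pick[OF pq(3)] by blast
      ultimately show ?thesis using pq True by (intro exI[of _ s] exI[of _ t]) simp
    next
      case False
      then have XD: "X \<subseteq> D" "2 \<le> card D" using light by auto
      obtain p q where pq: "p \<noteq> q" "p \<in> D" "q \<in> D" "X \<subseteq> {p, q}"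
        using between_two[OF XD(1) X2 _ XD(2)] finD by blast
      obtain s where "u s \<noteq> 0" "col s = p" "p \<in> D \<longrightarrow> 2 \<le> u s"
        using pick[OF subsetD[OF DS pq(2)]] by blast
      moreover obtain t where "u t \<noteq> 0" "col t = q" "q \<in> D \<longrightarrow> 2 \<le> u t"
        using pick[OF subsetD[OF DS pq(3)]] by blast
      ultimately show ?thesis using pq by (intro exI[of _ s] exI[of _ t]) simp
    qed
  qed
  then obtain s t where st: "u s \<noteq> 0" "u t \<noteq> 0" "col s \<noteq> col t" "X \<subseteq> {col s, col t}"
    and sD: "col s \<in> D \<Longrightarrow> 2 \<le> u s" and tD: "col t \<in> D \<Longrightarrow> 2 \<le> u t"
    and big: "i + 3 \<le> card S \<or> 2 \<le> u s \<and> 2 \<le> u t"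
    by blast
  have "s \<noteq> t" using st by auto
  then obtain v where v: "u = (\<lambda>x. edge_vector s t x + v x)" using remove_edge st by blast
  have vu: "v x = u x - of_bool (x = s) - of_bool (x = t)" for x
    by (simp add: v edge_vector_def)
  have "i < card {x. v x \<noteq> 0}"
  proof (cases "2 \<le> u s \<and> 2 \<le> u t")
    case True
    then have "{x. v x \<noteq> 0} = S" using \<open>s \<noteq> t\<close> by (auto simp: vu S_def of_bool_def)
    then show ?thesis using supp by simp
  next
    case False
    have "S - {s, t} \<subseteq> {x. v x \<noteq> 0}" by (auto simp: vu S_def)
    then have "card (S - {s, t}) \<le> card {x. v x \<noteq> 0}" by (intro card_mono) auto
    moreover have "card S - card {s, t} \<le> card (S - {s, t})" by (rule diff_card_le_card_Diff) simp
    moreover have "card {s, t} = 2" using \<open>s \<noteq> t\<close> by simp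
    moreover have "i + 3 \<le> card S" using False big by blast
    ultimately show ?thesis by linarith
  qed
  moreover have "weight v p \<le> k + i \<and> weight v p < k + card (colour_supp v p)" for p
  proof (cases "p = col s \<or> p = col t")
    case False
    then have "weight v p = weight u p" using weight_add_edge[OF v, of p] by auto
    moreover have "colour_supp v p = colour_supp u p" using False by (auto simp: colour_supp_def vu)
    moreover have "p \<notin> X" using st(4) False by auto
    ultimately show ?thesis using w1[of p] w2[of p] by (auto simp: X_def n_def)
  next
    case True
    then obtain r where r: "r = s \<or> r = t" "p = col r" by blast
    have rr: "x = s \<or> x = t \<longleftrightarrow> x = r" if "col x = p" for x using that r st(3) by auto
    have vr: "v x = u x - of_bool (x = r)" if "col x = p" for x
      using rr[OF that] \<open>s \<noteq> t\<close> by (cases "x = s"; cases "x = t") (auto simp: vu)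
    have ur: "u r \<noteq> 0" using r st by auto
    have w: "weight u p = weight v p + 1" using weight_add_edge[OF v, of p] r st(3) by auto
    show ?thesis
    proof (cases "p \<in> D")
      case True
      then have "2 \<le> u r" using r sD tD by auto
      then have "colour_supp v p = colour_supp u p"
        by (auto simp: colour_supp_def vr of_bool_def split: if_splits)
      then show ?thesis using w w1[of p] w2[of p] by (auto simp: n_def)
    next
      case False
      have "colour_supp u p - {r} \<subseteq> colour_supp v p"
        by (auto simp: colour_supp_def vr)
      then have "card (colour_supp u p - {r}) \<le> card (colour_supp v p)" by (intro card_mono) auto
      moreover have "r \<in> colour_supp u p" using ur r by (simp add: colour_supp_def)
      ultimately have "n p \<le> card (colour_supp v p) + 1" by (simp add: n_def)
      \<comment> \<open>Weight and support of this part agree and both drop by one with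
        \<open>r\<close>; the strict bound holds since \<open>k\<close> is positive.\<close>
      then show ?thesis using ones[OF False] w w1[of p] i ik by linarith
    qed
  qed
  moreover have "{x. v x \<noteq> 0} \<subseteq> V"
  proof
    fix x assume "x \<in> {x. v x \<noteq> 0}"
    then have "u x \<noteq> 0" using vu[of x] by simp
    then show "x \<in> V" using V by (auto simp: S_def)
  qed
  ultimately have "v \<in> shift_gens k i"
    using sum_add_edge[OF v] tot by (simp add: shift_gens_def)
  moreover have "s \<in> V" "t \<in> V" using st V by (auto simp: S_def)
  then have "edge_vector s t \<in> edge_vectors" unfolding edge_vectors_def using st(3) by blast
  ultimately show "u \<in> {\<lambda>x. e x + v x | e v. e \<in> edge_vectors \<and> v \<in> shift_gens k i}"
    by (intro CollectI exI[of _ "edge_vector s t"] exI[of _ v] conjI v)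
next
  fix u assume "u \<in> {\<lambda>x. e x + v x | e v. e \<in> edge_vectors \<and> v \<in> shift_gens k i}"
  then obtain s t v where u: "u = (\<lambda>x. edge_vector s t x + v x)"
    and st: "s \<in> V" "t \<in> V" "col s \<noteq> col t" and v: "v \<in> shift_gens k i"
    by (auto simp: edge_vectors_def)
  have "{x. u x \<noteq> 0} \<subseteq> insert s (insert t {x. v x \<noteq> 0})"
    by (auto simp: u edge_vector_def)
  then have "{x. u x \<noteq> 0} \<subseteq> V" using st v by (auto simp: shift_gens_def)
  moreover have "card {x. v x \<noteq> 0} \<le> card {x. u x \<noteq> 0}" by (intro card_mono) (auto simp: u)
  then have "i < card {x. u x \<noteq> 0}" using v by (simp add: shift_gens_def)
  moreover have "weight u p \<le> Suc k + i \<and> weight u p < Suc k + card (colour_supp u p)" for p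
  proof -
    have "card (colour_supp v p) \<le> card (colour_supp u p)"
      by (intro card_mono) (auto simp: u colour_supp_def)
    moreover have "weight u p \<le> weight v p + 1"
      using weight_add_edge[OF u, of p] st by auto
    moreover have "weight v p \<le> k + i" "weight v p < k + card (colour_supp v p)"
      using v by (simp_all add: shift_gens_def)
    ultimately show ?thesis by linarith
  qed
  ultimately show "u \<in> shift_gens (Suc k) i"
    using sum_add_edge[OF u] v by (simp add: shift_gens_def)
qed

end

section \<open>Lexicographic order and colon variables\<close>

locale ranked_vertices = coloured_vertices V col
  for V :: "'n::finite set" and col :: "'n \<Rightarrow> 'c" +
  fixes rank :: "'n \<Rightarrow> nat"
  assumes inj_rank: "inj rank"
begin

text \<open>Larger monomials come first, and the variable of smallest \<open>rank\<close> counts as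
  the largest.\<close>

definition lex_before :: "('n \<Rightarrow> nat) \<Rightarrow> ('n \<Rightarrow> nat) \<Rightarrow> bool" where
  "lex_before y x \<longleftrightarrow> (\<exists>s. x s < y s \<and> (\<forall>t. rank t < rank s \<longrightarrow> y t = x t))"

text \<open>The condition under which a later \<open>t\<close> in the support can be exchanged for
  \<open>s\<close> within \<open>power_gens k\<close>: the only weight that can rise is that of
  \<open>col s\<close> (\<open>power_gens_exchange\<close>).\<close>

definition colon_vars :: "nat \<Rightarrow> ('n \<Rightarrow> nat) \<Rightarrow> 'n set" where
  "colon_vars k u = {s \<in> V. \<exists>t. rank s < rank t \<and> u t \<noteq> 0 \<and> (col s = col t \<or> weight u (col s) < k)}"

lemma lex_before_trans:
  assumes "lex_before z y" "lex_before y x"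
  shows "lex_before z x"
proof -
  obtain s s' where s: "y s < z s" "\<And>t. rank t < rank s \<Longrightarrow> z t = y t"
    and s': "x s' < y s'" "\<And>t. rank t < rank s' \<Longrightarrow> y t = x t"
    using assms unfolding lex_before_def by blast
  consider "rank s < rank s'" | "rank s' < rank s" | "s = s'"
    using inj_rank by (metis injD linorder_neqE_nat)
  then show ?thesis
  proof cases
    case 1
    then show ?thesis unfolding lex_before_def
      using s s' by (intro exI[of _ s]) auto
  next
    case 2
    then show ?thesis unfolding lex_before_def
      using s s' by (intro exI[of _ s']) auto
  next
    case 3
    then show ?thesis unfolding lex_before_def
      using s s' by (intro exI[of _ s]) auto
  qed
qed

lemma lex_before_irrefl: "\<not> lex_before x x"
  by (simp add: lex_before_def)

lemma lex_before_total:
  assumes "x \<noteq> y"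
  shows "lex_before x y \<or> lex_before y x"
proof -
  obtain s0 where "x s0 \<noteq> y s0" using assms by blast
  then have "x (ARG_MIN rank s. x s \<noteq> y s) \<noteq> y (ARG_MIN rank s. x s \<noteq> y s) \<and>
      (\<forall>t. x t \<noteq> y t \<longrightarrow> rank (ARG_MIN rank s. x s \<noteq> y s) \<le> rank t)"
    by (rule arg_min_nat_lemma)
  then obtain s where s: "x s \<noteq> y s" "\<And>t. rank t < rank s \<Longrightarrow> x t = y t"
    by fastforce
  from s(1) have "x s < y s \<or> y s < x s" by linarith
  then show ?thesis
    unfolding lex_before_def using s(2) by (auto intro: exI[of _ s])
qed

lemma sum_card_indicator:
  fixes T :: "'n set"
  shows "finite A \<Longrightarrow> (\<Sum>s\<in>A. of_bool (s \<in> T) :: nat) = card (A \<inter> T)"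
  by (simp add: of_bool_def sum.If_cases Int_def)

lemma power_gens_exchange:
  assumes u: "u \<in> power_gens k" and s: "s \<in> V" and t: "u t \<noteq> 0" "s \<noteq> t"
    and st: "col s = col t \<or> weight u (col s) < k"
  shows "(\<lambda>x. u x + of_bool (x = s) - of_bool (x = t)) \<in> power_gens k"
proof -
  define w where "w = (\<lambda>x. u x - of_bool (x = t))"
  define v where "v = (\<lambda>x. u x + of_bool (x = s) - of_bool (x = t))"
  have uw: "u x = w x + of_bool (x = t)" for x using t by (auto simp: w_def)
  have vw: "v x = w x + of_bool (x = s)" for x using t by (auto simp: w_def v_def)
  have *: "(\<Sum>x\<in>A. of_bool (x = s) :: nat) = of_bool (s \<in> A)" if "finite A" for A and s :: 'n
    using that by (simp add: of_bool_def)
  have wu: "weight u p = weight w p + of_bool (col t = p)" for p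
    unfolding weight_def uw by (simp add: sum.distrib *)
  have wv: "weight v p = weight w p + of_bool (col s = p)" for p
    unfolding weight_def vw by (simp add: sum.distrib *)
  have "sum v UNIV = sum u UNIV"
    unfolding uw vw by (simp add: sum.distrib *)
  moreover have "weight v p \<le> k" for p
  proof -
    have "weight u p \<le> k" using u by (simp add: power_gens_def)
    then show ?thesis using wu[of p] wv[of p] st by (cases "col s = p") auto
  qed
  moreover have "{x. v x \<noteq> 0} \<subseteq> V"
  proof
    fix x assume "x \<in> {x. v x \<noteq> 0}"
    then have "x = s \<or> u x \<noteq> 0" by (auto simp: v_def)
    then show "x \<in> V" using s u by (auto simp: power_gens_def)
  qed
  ultimately have "v \<in> power_gens k" using u by (simp add: power_gens_def)
  then show ?thesis by (simp add: v_def)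
qed

lemma colon_vars_lex_before:
  assumes u: "u \<in> power_gens k" and s: "s \<in> colon_vars k u"
  shows "\<exists>v\<in>power_gens k. lex_before v u \<and> (\<forall>x. v x \<le> u x + of_bool (x = s))"
proof -
  obtain t where t: "rank s < rank t" "u t \<noteq> 0" "col s = col t \<or> weight u (col s) < k" and sV: "s \<in> V"
    using s unfolding colon_vars_def by blast
  then have st: "s \<noteq> t" by auto
  have "lex_before (\<lambda>x. u x + of_bool (x = s) - of_bool (x = t)) u"
    unfolding lex_before_def using st t(1) by (intro exI[of _ s]) auto
  then show ?thesis using power_gens_exchange[OF u sV t(2) st t(3)]
    by (intro bexI conjI) auto
qed

text \<open>At the first difference \<open>s\<close> the exponent of \<open>v\<close> is larger, so
  equal total degree yields a later \<open>t\<close> where it is smaller. If the colour of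
  \<open>s\<close> is already full in \<open>u\<close>, the same count inside this colour finds
  \<open>t\<close> there.\<close>

lemma lex_before_colon_vars:
  assumes u: "u \<in> power_gens k" and v: "v \<in> power_gens k" and vu: "lex_before v u"
  shows "\<exists>s\<in>colon_vars k u. u s < v s"
proof -
  obtain s where s: "u s < v s" and before: "\<And>t. rank t < rank s \<Longrightarrow> v t = u t"
    using vu unfolding lex_before_def by blast
  have later: "rank s < rank t" if "v t < u t" for t
  proof -
    have "rank t \<noteq> rank s" using inj_rank that s by (auto dest: injD)
    then show ?thesis using before[of t] that by fastforce
  qed
  have find: "\<exists>t\<in>A. v t < u t" if "finite A" "s \<in> A" "sum v A \<le> sum u A" for A
  proof (rule ccontr)
    assume "\<not> ?thesis"
    then have "sum u A < sum v A" using that s by (intro sum_strict_mono_ex1) (auto simp: not_less)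
    then show False using that by simp
  qed
  have "s \<in> V" using v s by (auto simp: power_gens_def)
  moreover have "\<exists>t. rank s < rank t \<and> u t \<noteq> 0 \<and> (col s = col t \<or> weight u (col s) < k)"
  proof (cases "weight u (col s) < k")
    case True
    then show ?thesis using find[of UNIV] later u v by (auto simp: power_gens_def) fastforce
  next
    case False
    then have "weight v (col s) \<le> weight u (col s)"
      using v by (auto simp: power_gens_def intro: order_trans)
    then obtain t where "col t = col s" "v t < u t"
      using find[of "{t. col t = col s}"] by (auto simp: weight_def)
    then show ?thesis using later by (intro exI[of _ t]) auto
  qed
  ultimately show ?thesis using s by (auto simp: colon_vars_def)
qed

lemma last_vertex:
  assumes "P s0"
  shows "\<exists>M. P M \<and> (\<forall>s. P s \<and> s \<noteq> M \<longrightarrow> rank s < rank M)"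
proof -
  have "finite (rank ` {s. P s})" "rank ` {s. P s} \<noteq> {}" using assms by auto
  then have "Max (rank ` {s. P s}) \<in> rank ` {s. P s}" by (rule Max_in)
  then obtain M where M: "P M" "rank M = Max (rank ` {s. P s})" by auto
  have "rank s < rank M" if "P s" "s \<noteq> M" for s
  proof -
    have "rank s \<le> rank M" unfolding M(2) using that by (intro Max_ge) auto
    moreover have "rank s \<noteq> rank M" using inj_rank that by (auto dest: injD)
    ultimately show ?thesis by simp
  qed
  then show ?thesis using M(1) by (intro exI[of _ M]) simp
qed

lemma weight_add_indicator:
  assumes "a = (\<lambda>s. x s + of_bool (s \<in> T))"
  shows "weight a p = weight x p + card ({s. col s = p} \<inter> T)"
    and "sum a UNIV = sum x UNIV + card T"
  unfolding weight_def assms by (simp_all add: sum.distrib sum_card_indicator)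

text \<open>The last vertex of the support of \<open>x\<close> has nothing after it and is never in
  \<open>T\<close>; likewise the last vertex of a part of full weight \<open>k\<close>. These
  omitted vertices account for the strict inequalities in \<open>shift_gens\<close>.\<close>

lemma colon_vars_shift_gens:
  assumes x: "x \<in> power_gens k" and k: "1 \<le> k" and T: "T \<subseteq> colon_vars k x" "card T = i"
    and a: "a = (\<lambda>s. x s + of_bool (s \<in> T))"
  shows "a \<in> shift_gens k i"
proof -
  have xV: "{s. x s \<noteq> 0} \<subseteq> V" and tot: "sum x UNIV = 2 * k" and wx: "\<And>p. weight x p \<le> k"
    using x by (auto simp: power_gens_def)
  have TV: "T \<subseteq> V" using T by (auto simp: colon_vars_def)
  have "\<exists>s. x s \<noteq> 0"
  proof (rule ccontr)
    assume "\<not> ?thesis"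
    then show False using tot k by simp
  qed
  then obtain s0 where "x s0 \<noteq> 0" by blast
  from last_vertex[of "\<lambda>s. x s \<noteq> 0", OF this]
  obtain M where M: "x M \<noteq> 0" "\<And>s. x s \<noteq> 0 \<Longrightarrow> s \<noteq> M \<Longrightarrow> rank s < rank M"
    by auto
  have "M \<notin> T"
  proof
    assume "M \<in> T"
    then obtain t where "rank M < rank t" "x t \<noteq> 0" using T by (auto simp: colon_vars_def)
    then show False using M(2)[of t] by auto
  qed
  have "insert M T \<subseteq> {s. a s \<noteq> 0}" using M by (auto simp: a)
  then have "card (insert M T) \<le> card {s. a s \<noteq> 0}" by (intro card_mono) auto
  then have "i < card {s. a s \<noteq> 0}" using \<open>M \<notin> T\<close> T by simp
  moreover have "weight a p \<le> k + i \<and> weight a p < k + card (colour_supp a p)" for p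
  proof -
    define Tp where "Tp = {s. col s = p} \<inter> T"
    have w: "weight a p = weight x p + card Tp"
      unfolding Tp_def by (rule weight_add_indicator[OF a])
    have "card Tp \<le> i" using T by (auto simp: Tp_def intro: card_mono)
    have sub: "Tp \<subseteq> colour_supp a p" by (auto simp: Tp_def colour_supp_def a)
    have "weight a p < k + card (colour_supp a p)"
    proof (cases "weight x p < k")
      case True
      have "card Tp \<le> card (colour_supp a p)" using sub by (intro card_mono) auto
      then show ?thesis using w True by simp
    next
      case False
      then have "weight x p \<noteq> 0" using k by simp
      then obtain s0 where "col s0 = p \<and> x s0 \<noteq> 0" unfolding weight_eq_0_iff by blast
      from last_vertex[of "\<lambda>s. col s = p \<and> x s \<noteq> 0", OF this]
      obtain N where N: "col N = p" "x N \<noteq> 0"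
        "\<And>s. col s = p \<Longrightarrow> x s \<noteq> 0 \<Longrightarrow> s \<noteq> N \<Longrightarrow> rank s < rank N"
        by auto
      have "N \<notin> Tp"
      proof
        assume "N \<in> Tp"
        then obtain t where "rank N < rank t" "x t \<noteq> 0" "col t = p"
          using T False N(1) by (auto simp: Tp_def colon_vars_def)
        then show False using N(3)[of t] by auto
      qed
      have "insert N Tp \<subseteq> colour_supp a p" using sub N by (auto simp: colour_supp_def a)
      then have "card (insert N Tp) \<le> card (colour_supp a p)" by (intro card_mono) auto
      then show ?thesis using \<open>N \<notin> Tp\<close> w wx[of p] by simp
    qed
    then show ?thesis using w wx[of p] \<open>card Tp \<le> i\<close> by simp
  qed
  moreover have "{s. a s \<noteq> 0} \<subseteq> V" using xV TV by (auto simp: a)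
  ultimately show ?thesis
    using weight_add_indicator(2)[OF a] tot T by (simp add: shift_gens_def)
qed

text \<open>\<open>T0\<close> takes the forced number of vertices from each part, avoiding the last
  one of the part, and is filled up to size \<open>i\<close> avoiding the last vertex
  \<open>M\<close> of the whole support. Then \<open>M\<close>, or in a full part its last vertex,
  is the later vertex demanded by \<open>colon_vars\<close>.\<close>

lemma shift_gens_colon_vars:
  assumes a: "a \<in> shift_gens k i"
  shows "\<exists>x\<in>power_gens k. \<exists>T\<subseteq>colon_vars k x. card T = i \<and> a = (\<lambda>s. x s + of_bool (s \<in> T))"
proof -
  define S where "S = {s. a s \<noteq> 0}"
  have SV: "S \<subseteq> V" and tot: "sum a UNIV = 2 * k + i" and cS: "i < card S"
    and w1: "\<And>p. weight a p \<le> k + i" and w2: "\<And>p. weight a p < k + card (colour_supp a p)"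
    using a by (auto simp: shift_gens_def S_def)
  have "S \<noteq> {}" using cS by auto
  then obtain s0 where "a s0 \<noteq> 0" by (auto simp: S_def)
  from last_vertex[of "\<lambda>s. a s \<noteq> 0", OF this]
  obtain M where M: "a M \<noteq> 0" "\<And>s. a s \<noteq> 0 \<Longrightarrow> s \<noteq> M \<Longrightarrow> rank s < rank M"
    by auto
  \<comment> \<open>Truncated subtraction: a part of weight at most \<open>k\<close> forces
    nothing.\<close>
  define c where "c p = weight a p - k" for p
  define good where "good p Q \<longleftrightarrow> Q \<subseteq> colour_supp a p \<and> card Q = c p \<and>
      (\<exists>N\<in>colour_supp a p - Q. \<forall>s\<in>colour_supp a p. s \<noteq> N \<longrightarrow> rank s < rank N)" for p Q
  have "\<exists>Q. colour_supp a p \<noteq> {} \<longrightarrow> good p Q" for p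
  proof (cases "colour_supp a p = {}")
    case False
    then obtain s1 where "col s1 = p \<and> a s1 \<noteq> 0" by (auto simp: colour_supp_def)
    from last_vertex[of "\<lambda>s. col s = p \<and> a s \<noteq> 0", OF this]
    obtain N where N: "N \<in> colour_supp a p" "\<forall>s\<in>colour_supp a p. s \<noteq> N \<longrightarrow> rank s < rank N"
      by (auto simp: colour_supp_def)
    have "c p \<le> card (colour_supp a p - {N})"
      using w2[of p] N(1) by (simp add: c_def)
    then obtain Q where "Q \<subseteq> colour_supp a p - {N}" "card Q = c p"
      by (rule obtain_subset_with_card_n)
    then have "good p Q" using N unfolding good_def by blast
    then show ?thesis by blast
  qed simp
  then have "\<forall>p. \<exists>Q. colour_supp a p \<noteq> {} \<longrightarrow> good p Q" ..
  from choice[OF this] obtain Q where good: "\<And>p. colour_supp a p \<noteq> {} \<Longrightarrow> good p (Q p)"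
    by blast
  have Q: "Q p \<subseteq> colour_supp a p" and cQ: "card (Q p) = c p"
    and NQ: "\<exists>N\<in>colour_supp a p - Q p. \<forall>s\<in>colour_supp a p. s \<noteq> N \<longrightarrow> rank s < rank N"
    if "colour_supp a p \<noteq> {}" for p
    using good[OF that] unfolding good_def by simp_all
  define T0 where "T0 = {s. a s \<noteq> 0 \<and> s \<in> Q (col s)}"
  have T0_col: "{s. col s = p} \<inter> T0 = Q p" if "colour_supp a p \<noteq> {}" for p
    using Q[OF that] by (auto simp: T0_def colour_supp_def)
  have T0_M: "T0 \<subseteq> S - {M}"
  proof
    fix s assume s: "s \<in> T0"
    have ss: "s \<in> colour_supp a (col s)" using s by (auto simp: T0_def colour_supp_def)
    then obtain N where N: "N \<in> colour_supp a (col s) - Q (col s)"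
      "\<forall>t\<in>colour_supp a (col s). t \<noteq> N \<longrightarrow> rank t < rank N"
      using NQ[of "col s"] by blast
    have "s \<noteq> N" using s N by (auto simp: T0_def)
    then have "rank s < rank N" using N ss by blast
    then have "s \<noteq> M" using M(2)[of N] N(1) by (cases "N = M") (auto simp: colour_supp_def)
    then show "s \<in> S - {M}" using s by (simp add: T0_def S_def)
  qed
  have "card T0 \<le> i"
  proof -
    define P where "P = {p \<in> col ` S. k < weight a p}"
    have finP: "finite P" by (simp add: P_def)
    have "card T0 = (\<Sum>p\<in>col ` S. card ({s. col s = p} \<inter> T0))"
    proof -
      have "card T0 = (\<Sum>p\<in>col ` T0. card {s. s \<in> T0 \<and> col s = p})"
        using sum.image_gen[of T0 "\<lambda>_. 1 :: nat" col] by simp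
      also have "\<dots> = (\<Sum>p\<in>col ` S. card {s. s \<in> T0 \<and> col s = p})"
      proof (intro sum.mono_neutral_left ballI)
        show "col ` T0 \<subseteq> col ` S" using T0_M by blast
        fix p assume "p \<in> col ` S - col ` T0"
        then have "{s. s \<in> T0 \<and> col s = p} = {}" by blast
        then show "card {s. s \<in> T0 \<and> col s = p} = 0" by simp
      qed simp
      also have "\<dots> = (\<Sum>p\<in>col ` S. card ({s. col s = p} \<inter> T0))"
        by (intro sum.cong arg_cong[of _ _ card]) auto
      finally show ?thesis .
    qed
    also have "\<dots> = (\<Sum>p\<in>col ` S. c p)"
    proof (rule sum.cong[OF refl])
      fix p assume "p \<in> col ` S"
      then have "colour_supp a p \<noteq> {}" by (auto simp: S_def colour_supp_def)
      then show "card ({s. col s = p} \<inter> T0) = c p" using T0_col cQ by simp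
    qed
    also have "\<dots> = (\<Sum>p\<in>P. c p)"
      by (intro sum.mono_neutral_right) (auto simp: P_def c_def)
    also have "\<dots> \<le> i"
    proof -
      have "(\<Sum>p\<in>P. c p) + card P * k = (\<Sum>p\<in>P. weight a p)"
      proof -
        have "(\<Sum>p\<in>P. weight a p) = (\<Sum>p\<in>P. c p + k)"
          by (rule sum.cong) (auto simp: P_def c_def)
        then show ?thesis by (simp add: sum.distrib)
      qed
      then have le: "(\<Sum>p\<in>P. c p) + card P * k \<le> 2 * k + i"
        using sum_weight_le[OF finP, of a] tot by simp
      \<comment> \<open>A single heavy part obeys \<open>weight a p \<le> k + i\<close>; two or more
        absorb at least \<open>2 * k\<close> of the total degree \<open>2 * k + i\<close> and leave
        at most \<open>i\<close>.\<close>
      consider "card P = 0" | "card P = 1" | "2 \<le> card P" by linarith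
      then show ?thesis
      proof cases
        case 1
        then show ?thesis using finP by simp
      next
        case 2
        then obtain p where "P = {p}" using card_1_singletonE by blast
        then show ?thesis using w1[of p] by (simp add: c_def)
      next
        case 3
        then have "2 * k \<le> card P * k" by simp
        then show ?thesis using le by linarith
      qed
    qed
    finally show ?thesis .
  qed
  moreover have "i \<le> card (S - {M})" using cS M(1) by (simp add: S_def)
  ultimately obtain T where T: "T0 \<subseteq> T" "T \<subseteq> S - {M}" "card T = i"
    using exists_subset_between[of T0 i "S - {M}"] T0_M by auto
  define x where "x s = a s - of_bool (s \<in> T)" for s
  have ax: "a = (\<lambda>s. x s + of_bool (s \<in> T))"
    using T by (auto simp: x_def S_def fun_eq_iff)
  have card_Q: "c p \<le> card ({s. col s = p} \<inter> T)" if "colour_supp a p \<noteq> {}" for p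
  proof -
    have "Q p \<subseteq> {s. col s = p} \<inter> T" using T0_col[OF that] T(1) by blast
    then show ?thesis unfolding cQ[OF that, symmetric] by (intro card_mono) auto
  qed
  have wx: "weight x p \<le> k" for p
  proof (cases "colour_supp a p = {}")
    case True
    then have "weight a p = 0" unfolding weight_eq_0_iff by (auto simp: colour_supp_def)
    then show ?thesis using weight_add_indicator(1)[OF ax, of p] by simp
  next
    case False
    then show ?thesis using card_Q[OF False] weight_add_indicator(1)[OF ax, of p] by (simp add: c_def)
  qed
  have "{s. x s \<noteq> 0} \<subseteq> S" by (auto simp: x_def S_def intro: gr0I)
  then have "{s. x s \<noteq> 0} \<subseteq> V" using SV by blast
  then have x: "x \<in> power_gens k"
    using wx weight_add_indicator(2)[OF ax] tot T(3) by (simp add: power_gens_def)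
  have "T \<subseteq> colon_vars k x"
  proof
    fix s assume s: "s \<in> T"
    then have sS: "a s \<noteq> 0" "s \<noteq> M" using T by (auto simp: S_def)
    have "\<exists>t. rank s < rank t \<and> x t \<noteq> 0 \<and> (col s = col t \<or> weight x (col s) < k)"
    proof (cases "weight x (col s) < k")
      case True
      have "M \<notin> T" using T by blast
      then show ?thesis using True M sS by (intro exI[of _ M]) (auto simp: x_def)
    next
      case False
      define p where "p = col s"
      have sp: "s \<in> colour_supp a p" using sS by (simp add: p_def colour_supp_def)
      then have ne: "colour_supp a p \<noteq> {}" by blast
      \<comment> \<open>Weight exactly \<open>k\<close> after removing \<open>T\<close> means that
        \<open>T\<close> took only the forced vertices of this part, so its last vertex
        \<open>N\<close> is left.\<close>
      have "card ({s. col s = p} \<inter> T) = c p"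
        using False wx[of p] weight_add_indicator(1)[OF ax, of p] by (simp add: c_def p_def)
      moreover have "Q p \<subseteq> {s. col s = p} \<inter> T" using T0_col[OF ne] T(1) by blast
      ultimately have TQ: "{s. col s = p} \<inter> T = Q p"
        using cQ[OF ne] card_subset_eq[of "{s. col s = p} \<inter> T" "Q p"] by simp
      obtain N where N: "N \<in> colour_supp a p" "N \<notin> Q p"
        "\<forall>t\<in>colour_supp a p. t \<noteq> N \<longrightarrow> rank t < rank N"
        using NQ[OF ne] by blast
      have "s \<in> Q p" using TQ s by (auto simp: p_def)
      then have "s \<noteq> N" using N(2) by auto
      then have "rank s < rank N" using N(3) sp by simp
      moreover have "N \<notin> T" using N(1,2) TQ by (auto simp: colour_supp_def)
      then have "x N \<noteq> 0" using N(1) by (simp add: x_def colour_supp_def)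
      moreover have "col N = col s" using N(1) by (simp add: colour_supp_def p_def)
      ultimately show ?thesis by (intro exI[of _ N]) simp
    qed
    then show "s \<in> colon_vars k x" using SV sS by (auto simp: colon_vars_def S_def)
  qed
  then show ?thesis using x T(3) ax by blast
qed

section \<open>\<open>Tor\<close> of the powers\<close>

lemma linear_quotients_power_gens:
  "linear_quotients {x. Poly_Mapping.lookup x \<in> power_gens k}
     (\<lambda>y x. lex_before (Poly_Mapping.lookup y) (Poly_Mapping.lookup x))
     (\<lambda>x. colon_vars k (Poly_Mapping.lookup x)) (2 * k)"
proof
  have "Poly_Mapping.lookup ` {x. Poly_Mapping.lookup x \<in> power_gens k} \<subseteq> (\<Pi>\<^sub>E s\<in>UNIV. {..2 * k})"
  proof
    fix u assume "u \<in> Poly_Mapping.lookup ` {x. Poly_Mapping.lookup x \<in> power_gens k}"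
    then have "sum u UNIV = 2 * k" by (auto simp: power_gens_def)
    then have "u s \<le> 2 * k" for s using member_le_sum[of s UNIV u] by simp
    then show "u \<in> (\<Pi>\<^sub>E s\<in>UNIV. {..2 * k})" by (simp add: PiE_def)
  qed
  then have "finite (Poly_Mapping.lookup ` {x. Poly_Mapping.lookup x \<in> power_gens k})"
    by (rule finite_subset) (simp add: finite_PiE)
  then show "finite {x. Poly_Mapping.lookup x \<in> power_gens k}"
    by (rule finite_imageD) (simp add: inj_on_def)
next
  show "transp_on {x. Poly_Mapping.lookup x \<in> power_gens k}
     (\<lambda>y x. lex_before (Poly_Mapping.lookup y) (Poly_Mapping.lookup x))"
    by (rule transp_onI) (rule lex_before_trans)
  show "asymp_on {x. Poly_Mapping.lookup x \<in> power_gens k}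
     (\<lambda>y x. lex_before (Poly_Mapping.lookup y) (Poly_Mapping.lookup x))"
    using lex_before_trans lex_before_irrefl by (intro asymp_onI) blast
  show "totalp_on {x. Poly_Mapping.lookup x \<in> power_gens k}
     (\<lambda>y x. lex_before (Poly_Mapping.lookup y) (Poly_Mapping.lookup x))"
  proof (rule totalp_onI)
    fix x y :: "'n \<Rightarrow>\<^sub>0 nat" assume "x \<noteq> y"
    then have "Poly_Mapping.lookup x \<noteq> Poly_Mapping.lookup y"
      using poly_mapping_eqI[of x y] by auto
    from lex_before_total[OF this]
    show "lex_before (Poly_Mapping.lookup x) (Poly_Mapping.lookup y) \<or>
        lex_before (Poly_Mapping.lookup y) (Poly_Mapping.lookup x)" .
  qed
next
  fix x assume "x \<in> {x. Poly_Mapping.lookup x \<in> power_gens k}"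
  then have x: "Poly_Mapping.lookup x \<in> power_gens k" by simp
  show "sum (Poly_Mapping.lookup x) UNIV = 2 * k" using x by (simp add: power_gens_def)
  show "\<exists>s\<in>colon_vars k (Poly_Mapping.lookup x). Poly_Mapping.lookup x s < Poly_Mapping.lookup y s"
    if "y \<in> {x. Poly_Mapping.lookup x \<in> power_gens k}"
      "lex_before (Poly_Mapping.lookup y) (Poly_Mapping.lookup x)" for y
    using lex_before_colon_vars[OF x _ that(2)] that(1) by simp
  show "\<exists>y\<in>{x. Poly_Mapping.lookup x \<in> power_gens k}.
      lex_before (Poly_Mapping.lookup y) (Poly_Mapping.lookup x) \<and>
      (\<forall>t. Poly_Mapping.lookup y t \<le> Poly_Mapping.lookup x t + of_bool (t = s))"
    if s: "s \<in> colon_vars k (Poly_Mapping.lookup x)" for s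
  proof -
    obtain v where v: "v \<in> power_gens k" "lex_before v (Poly_Mapping.lookup x)"
      "\<forall>t. v t \<le> Poly_Mapping.lookup x t + of_bool (t = s)"
      using colon_vars_lex_before[OF x s] by blast
    have "Poly_Mapping.lookup (Abs_poly_mapping v) = v" by simp
    then show ?thesis using v by (intro bexI[of _ "Abs_poly_mapping v"]) auto
  qed
qed

lemma Tor_nonzero_power:
  assumes k: "1 \<le> k"
  shows "Tor_nonzero i (ideal.span (monomial ` {x. Poly_Mapping.lookup x \<in> power_gens k})
        :: ('n, 'k::field) polyring set) (\<lambda>s. int (Poly_Mapping.lookup a s)) \<longleftrightarrow>
     (\<exists>F :: ('n, 'k) free_complex. resolves_residue_field F) \<and>
     Poly_Mapping.lookup a \<in> shift_gens k i"
proof -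
  interpret linear_quotients "{x. Poly_Mapping.lookup x \<in> power_gens k}"
     "\<lambda>y x. lex_before (Poly_Mapping.lookup y) (Poly_Mapping.lookup x)"
     "\<lambda>x. colon_vars k (Poly_Mapping.lookup x)" "2 * k"
    by (rule linear_quotients_power_gens)
  have eq: "(\<lambda>s. int (Poly_Mapping.lookup a s)) = (\<lambda>s. int (u s) + of_bool (s \<in> T)) \<longleftrightarrow>
      Poly_Mapping.lookup a = (\<lambda>s. u s + of_bool (s \<in> T))" for u and T :: "'n set"
  proof -
    have "int (u s) + of_bool (s \<in> T) = int (u s + of_bool (s \<in> T))" for s by simp
    then show ?thesis unfolding fun_eq_iff by (simp only: of_nat_eq_iff)
  qed
  have "(\<lambda>s. int (Poly_Mapping.lookup a s))
      \<in> betti_degrees {x. Poly_Mapping.lookup x \<in> power_gens k} i \<longleftrightarrow>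
    (\<exists>u\<in>power_gens k. \<exists>T\<subseteq>colon_vars k u. card T = i \<and> Poly_Mapping.lookup a = (\<lambda>s. u s + of_bool (s \<in> T)))"
  proof -
    have "(\<exists>x. P (Poly_Mapping.lookup x)) \<longleftrightarrow> (\<exists>u. P u)" for P :: "('n \<Rightarrow> nat) \<Rightarrow> bool"
    proof
      assume "\<exists>u. P u"
      then obtain u where "P u" ..
      then have "P (Poly_Mapping.lookup (Abs_poly_mapping u))" by simp
      then show "\<exists>x. P (Poly_Mapping.lookup x)" ..
    qed auto
    then show ?thesis unfolding betti_degrees_def mem_Collect_eq eq Bex_def .
  qed
  also have "\<dots> \<longleftrightarrow> Poly_Mapping.lookup a \<in> shift_gens k i"
    using shift_gens_colon_vars colon_vars_shift_gens[OF _ k] by blast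
  finally show ?thesis unfolding Tor_nonzero_iff by simp
qed

end

section \<open>Matroidal edge ideals\<close>

lemma ideal_prod_span_monomials:
  "ideal_prod (ideal.span (monomial ` A)) (ideal.span (monomial ` B))
     = (ideal.span (monomial ` {a + b | a b. a \<in> A \<and> b \<in> B}) :: ('n, 'k::comm_ring_1) polyring set)"
    (is "_ = ideal.span (monomial ` ?C)")
proof (intro equalityI)
  show "ideal_prod (ideal.span (monomial ` A)) (ideal.span (monomial ` B))
      \<subseteq> (ideal.span (monomial ` ?C) :: ('n, 'k) polyring set)"
    unfolding ideal_prod_def
  proof (rule ideal.span_minimal)
    show "{f * g | f g. f \<in> ideal.span (monomial ` A) \<and> g \<in> ideal.span (monomial ` B)}
        \<subseteq> (ideal.span (monomial ` ?C) :: ('n, 'k) polyring set)"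
    proof clarify
      fix f g :: "('n, 'k) polyring"
      assume f: "f \<in> ideal.span (monomial ` A)" and g: "g \<in> ideal.span (monomial ` B)"
      have "\<exists>x\<in>?C. \<exists>y. m = x + y" if m: "m \<in> Poly_Mapping.keys (f * g)" for m
      proof -
        obtain p q where pq: "m = p + q" "p \<in> Poly_Mapping.keys f" "q \<in> Poly_Mapping.keys g"
          using m keys_mult[of f g] by blast
        obtain a y where a: "a \<in> A" "p = a + y" using f pq(2) unfolding mem_span_monomials by blast
        obtain b z where b: "b \<in> B" "q = b + z" using g pq(3) unfolding mem_span_monomials by blast
        have "m = (a + b) + (y + z)" unfolding pq(1) a(2) b(2) by (simp add: algebra_simps)
        moreover have "a + b \<in> ?C" using a(1) b(1) by blast
        ultimately show ?thesis by blast
      qed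
      then show "f * g \<in> ideal.span (monomial ` ?C)" unfolding mem_span_monomials by blast
    qed
  qed simp
next
  show "(ideal.span (monomial ` ?C) :: ('n, 'k) polyring set)
      \<subseteq> ideal_prod (ideal.span (monomial ` A)) (ideal.span (monomial ` B))"
    unfolding ideal_prod_def
  proof (rule ideal.span_mono, clarify)
    fix a b assume "a \<in> A" "b \<in> B"
    then show "\<exists>f g. monomial (a + b) = f * g \<and> f \<in> ideal.span (monomial ` A) \<and>
        g \<in> (ideal.span (monomial ` B) :: ('n, 'k) polyring set)"
      by (intro exI[of _ "monomial a"] exI[of _ "monomial b"])
        (auto simp: monomial_def mult_single intro: ideal.span_base)
  qed
qed

lemma monomial_mem_span:
  "monomial x \<in> (ideal.span (monomial ` A) :: ('n, 'k::comm_ring_1) polyring set)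
    \<longleftrightarrow> (\<exists>y\<in>A. \<exists>z. x = y + z)"
  unfolding mem_span_monomials by (simp add: monomial_def)

lemma monomial_mem_span_same_degree:
  assumes "monomial x \<in> (ideal.span (monomial ` A) :: ('n::finite, 'k::comm_ring_1) polyring set)"
    and "\<And>y. y \<in> A \<Longrightarrow> (\<Sum>s\<in>UNIV. Poly_Mapping.lookup y s) = (\<Sum>s\<in>UNIV. Poly_Mapping.lookup x s)"
  shows "x \<in> A"
proof -
  obtain y z where y: "y \<in> A" "x = y + z"
    using assms(1) unfolding monomial_mem_span by blast
  have "(\<Sum>s\<in>UNIV. Poly_Mapping.lookup z s) = 0"
    using assms(2)[OF y(1)] by (simp add: y(2) lookup_add sum.distrib)
  then have "z = 0" by (intro poly_mapping_eqI) simp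
  then show ?thesis using y by simp
qed

text \<open>Distinct monomials of one degree do not divide each other, so no element of
  \<open>A\<close> is redundant. In another generating set some \<open>x'\<close> divides a given
  \<open>x\<close> of \<open>A\<close> and is itself divisible by an \<open>x''\<close> in
  \<open>A\<close>; equal degrees force all three to agree.\<close>

lemma min_gens_span_monomials:
  fixes A :: "('n::finite \<Rightarrow>\<^sub>0 nat) set"
  assumes deg: "\<And>x. x \<in> A \<Longrightarrow> (\<Sum>s\<in>UNIV. Poly_Mapping.lookup x s) = d"
  shows "min_gens (ideal.span (monomial ` A) :: ('n, 'k::comm_ring_1) polyring set) = A"
  unfolding min_gens_def
proof (rule the_equality)
  let ?span = "\<lambda>A. ideal.span (monomial ` A) :: ('n, 'k) polyring set"
  show "?span A = ?span A \<and> (\<forall>B. B \<subset> A \<longrightarrow> ?span B \<noteq> ?span A)"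
  proof (intro conjI allI impI notI)
    fix B assume B: "B \<subset> A" and eq: "?span B = ?span A"
    then obtain x where x: "x \<in> A" "x \<notin> B" by blast
    have "monomial x \<in> ?span B" unfolding eq using x by (intro ideal.span_base) simp
    then have "x \<in> B"
      by (rule monomial_mem_span_same_degree) (use B x deg in auto)
    then show False using x by simp
  qed simp
  fix A' assume A': "?span A' = ?span A \<and> (\<forall>B. B \<subset> A' \<longrightarrow> ?span B \<noteq> ?span A)"
  have "A \<subseteq> A'"
  proof
    fix x assume x: "x \<in> A"
    have "monomial x \<in> ?span A'" unfolding conjunct1[OF A'] using x by (intro ideal.span_base) simp
    then obtain x' y where x': "x' \<in> A'" "x = x' + y"
      unfolding monomial_mem_span by blast
    have "monomial x' \<in> ?span A"
      unfolding conjunct1[OF A', symmetric] using x'(1) by (intro ideal.span_base) simp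
    then obtain x'' z where x'': "x'' \<in> A" "x' = x'' + z"
      unfolding monomial_mem_span by blast
    have "(\<Sum>s\<in>UNIV. Poly_Mapping.lookup y s) = 0"
      using deg[OF x] deg[OF x''(1)] by (simp add: x'(2) x''(2) lookup_add sum.distrib)
    then have "y = 0" by (intro poly_mapping_eqI) simp
    then show "x \<in> A'" using x' by simp
  qed
  then show "A' = A" using A' by blast
qed

definition edge_exponents :: "'n set set \<Rightarrow> ('n \<Rightarrow>\<^sub>0 nat) set" where
  "edge_exponents E = {Poly_Mapping.single i 1 + Poly_Mapping.single j 1 | i j. {i, j} \<in> E}"

lemma edge_ideal_eq:
  "edge_ideal E = (ideal.span (monomial ` edge_exponents E) :: ('n, 'k::comm_ring_1) polyring set)"
proof -
  have "{Var i * Var j | i j. {i, j} \<in> E} = (monomial ` edge_exponents E :: ('n, 'k) polyring set)"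
    by (auto simp: edge_exponents_def Var_def monomial_def mult_single image_iff; blast)
  then show ?thesis by (simp add: edge_ideal_def)
qed

lemma edge_exponents_iff:
  "Poly_Mapping.single i 1 + Poly_Mapping.single j 1 \<in> edge_exponents E \<longleftrightarrow> {i, j} \<in> E"
proof
  assume "Poly_Mapping.single i 1 + Poly_Mapping.single j 1 \<in> edge_exponents E"
  then obtain p q where pq: "{p, q} \<in> E"
    and eq: "Poly_Mapping.single i 1 + Poly_Mapping.single j 1
      = (Poly_Mapping.single p 1 + Poly_Mapping.single q 1 :: 'a \<Rightarrow>\<^sub>0 nat)"
    unfolding edge_exponents_def by blast
  have "s \<in> {i, j} \<longleftrightarrow> s \<in> {p, q}" for s
  proof -
    have "Poly_Mapping.lookup (Poly_Mapping.single i 1 + Poly_Mapping.single j (1::nat)) s \<noteq> 0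
        \<longleftrightarrow> s \<in> {i, j}" for i j
      by (auto simp: lookup_add lookup_single when_def)
    then show ?thesis using eq by metis
  qed
  then have "{i, j} = {p, q}" by blast
  then show "{i, j} \<in> E" using pq by simp
qed (auto simp: edge_exponents_def)

lemma edge_exponents_degree:
  fixes x :: "'n::finite \<Rightarrow>\<^sub>0 nat"
  assumes "x \<in> edge_exponents E"
  shows "(\<Sum>s\<in>UNIV. Poly_Mapping.lookup x s) = 2"
  using assms by (auto simp: edge_exponents_def lookup_add lookup_single when_def sum.distrib)

text \<open>Matroidality of an edge ideal says that being adjacent to neither end of an edge is only
  possible for isolated vertices, so non-adjacency is transitive on the other vertices and the
  graph is complete multipartite.\<close>

lemma matroidal_edge_exchange:
  assumes simple: "\<And>e. e \<in> E \<Longrightarrow> card e = 2"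
    and matroidal: "matroidal (edge_ideal E :: ('n::finite, 'k::comm_ring_1) polyring set)"
    and ab: "{a, b} \<in> E" and cd: "{c, d} \<in> E"
  shows "{c, a} \<in> E \<or> {c, b} \<in> E"
proof -
  have gens: "min_gens (edge_ideal E :: ('n, 'k) polyring set) = edge_exponents E"
    unfolding edge_ideal_eq by (rule min_gens_span_monomials) (rule edge_exponents_degree)
  let ?e = "\<lambda>i j. Poly_Mapping.single i 1 + Poly_Mapping.single j 1 :: 'n \<Rightarrow>\<^sub>0 nat"
  have exch: "\<exists>j. Poly_Mapping.lookup u j < Poly_Mapping.lookup v j \<and>
      Poly_Mapping.single j 1 + (u - Poly_Mapping.single i 1) \<in> edge_exponents E"
    if "u \<in> edge_exponents E" "v \<in> edge_exponents E" "Poly_Mapping.lookup u i > Poly_Mapping.lookup v i" for u v i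
    using matroidal that unfolding matroidal_def polymatroidal_def gens by blast
  show ?thesis
  proof (cases "c \<in> {a, b} \<or> d \<in> {a, b}")
    case True
    then show ?thesis using ab cd by (auto simp: insert_commute)
  next
    case False
    have "c \<noteq> d" using simple[OF cd] by auto
    have lt: "Poly_Mapping.lookup (?e a b) d < Poly_Mapping.lookup (?e c d) d"
      using False by (auto simp: lookup_add lookup_single when_def)
    have "?e c d \<in> edge_exponents E" "?e a b \<in> edge_exponents E"
      unfolding edge_exponents_iff by (fact cd, fact ab)
    \<comment> \<open>Exchanging \<open>d\<close> against the edge \<open>{a, b}\<close> can only
      bring in \<open>a\<close> or \<open>b\<close>, while \<open>c\<close> stays.\<close>
    from exch[OF this lt]
    obtain j where j: "Poly_Mapping.lookup (?e c d) j < Poly_Mapping.lookup (?e a b) j"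
      and mem: "Poly_Mapping.single j 1 + (?e c d - Poly_Mapping.single d 1) \<in> edge_exponents E"
      by (elim exE conjE)
    have "j \<in> {a, b}" using j by (auto simp: lookup_add lookup_single when_def split: if_splits)
    moreover have "?e c d - Poly_Mapping.single d 1 = Poly_Mapping.single c 1" by simp
    then have "{c, j} \<in> E" using mem edge_exponents_iff[of j c E] by (simp add: insert_commute)
    ultimately show ?thesis by blast
  qed
qed

lemma sumset_lookup:
  fixes P Q :: "('n::finite \<Rightarrow> nat) set"
  shows "{a + b | a b. Poly_Mapping.lookup a \<in> P \<and> Poly_Mapping.lookup b \<in> Q}
    = {x. Poly_Mapping.lookup x \<in> {\<lambda>s. u s + v s | u v. u \<in> P \<and> v \<in> Q}}"
proof (intro equalityI subsetI)
  fix x assume "x \<in> {a + b | a b. Poly_Mapping.lookup a \<in> P \<and> Poly_Mapping.lookup b \<in> Q}"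
  then obtain a b where "x = a + b" "Poly_Mapping.lookup a \<in> P" "Poly_Mapping.lookup b \<in> Q" by blast
  moreover have "Poly_Mapping.lookup (a + b) = (\<lambda>s. Poly_Mapping.lookup a s + Poly_Mapping.lookup b s)"
    by (simp add: fun_eq_iff lookup_add)
  ultimately show "x \<in> {x. Poly_Mapping.lookup x \<in> {\<lambda>s. u s + v s | u v. u \<in> P \<and> v \<in> Q}}" by blast
next
  fix x assume "x \<in> {x. Poly_Mapping.lookup x \<in> {\<lambda>s. u s + v s | u v. u \<in> P \<and> v \<in> Q}}"
  then obtain u v where uv: "Poly_Mapping.lookup x = (\<lambda>s. u s + v s)" "u \<in> P" "v \<in> Q" by blast
  have "x = Abs_poly_mapping u + Abs_poly_mapping v"
    by (rule poly_mapping_eqI) (simp add: lookup_add uv(1))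
  moreover have "Poly_Mapping.lookup (Abs_poly_mapping u) \<in> P" "Poly_Mapping.lookup (Abs_poly_mapping v) \<in> Q"
    using uv by simp_all
  ultimately show "x \<in> {a + b | a b. Poly_Mapping.lookup a \<in> P \<and> Poly_Mapping.lookup b \<in> Q}" by blast
qed

theorem proposition5p10:
  fixes E :: "'n::finite set set"
    and I :: "('n, 'k::field) polyring set"
    and i k :: nat
  assumes simple_graph: "\<And>e. e \<in> E \<Longrightarrow> card e = 2"
    and I_def: "I = edge_ideal E"
    and matroidal: "matroidal I"
    and "1 \<le> i" and "i \<le> k"
  shows "HS i (ideal_pow I (k + 1)) = ideal_prod I (HS i (ideal_pow I k))"
proof -
  define V where "V = \<Union> E"
  \<comment> \<open>A part is named by its set of non-neighbours, which for a vertex of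
    \<open>V\<close> contains the vertex itself since there are no loops.\<close>
  define col where "col s = {t \<in> V. {s, t} \<notin> E}" for s
  obtain rank :: "'n \<Rightarrow> nat" where "inj rank"
    using finite_imp_inj_to_nat_seg[of "UNIV :: 'n set"] by auto
  interpret ranked_vertices V col rank by unfold_locales (rule \<open>inj rank\<close>)
  have exch: "{c, a} \<in> E \<or> {c, b} \<in> E" if "{a, b} \<in> E" "{c, d} \<in> E" for a b c d
    by (rule matroidal_edge_exchange[OF simple_graph matroidal[unfolded I_def] that])
  have edge_in_V: "s \<in> V" "t \<in> V" if "{s, t} \<in> E" for s t
    using that unfolding V_def by auto
  have neighbour: "\<exists>t. {s, t} \<in> E" if s: "s \<in> V" for s
  proof -
    obtain e where e: "e \<in> E" "s \<in> e" using s by (auto simp: V_def)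
    then have "card e = 2" using simple_graph by blast
    then obtain p q where "e = {p, q}" unfolding card_2_iff by blast
    then show ?thesis using e by (auto simp: insert_commute)
  qed
  have no_loop: "{s, s} \<notin> E" for s using simple_graph[of "{s, s}"] by auto
  \<comment> \<open>The exchange property for the edges \<open>{s, x}\<close> and
    \<open>{t, d}\<close> joins \<open>t\<close> to \<open>s\<close> or to \<open>x\<close>, and
    \<open>s\<close> is excluded. So non-adjacent vertices of \<open>V\<close> have the same
    neighbours.\<close>
  have transfer: "{t, x} \<in> E" if sx: "{s, x} \<in> E" and st: "{s, t} \<notin> E" and t: "t \<in> V" for s t x
  proof -
    obtain d where "{t, d} \<in> E" using neighbour[OF t] by blast
    from exch[OF sx this] show ?thesis using st by (simp add: insert_commute)
  qed
  have adj: "{s, t} \<in> E \<longleftrightarrow> s \<in> V \<and> t \<in> V \<and> col s \<noteq> col t" for s t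
  proof
    assume st: "{s, t} \<in> E"
    then have "s \<in> col s" "s \<notin> col t"
      using edge_in_V no_loop by (auto simp: col_def insert_commute)
    then show "s \<in> V \<and> t \<in> V \<and> col s \<noteq> col t" using st edge_in_V by blast
  next
    assume *: "s \<in> V \<and> t \<in> V \<and> col s \<noteq> col t"
    show "{s, t} \<in> E"
    proof (rule ccontr)
      assume st: "{s, t} \<notin> E"
      have "{s, x} \<in> E \<longleftrightarrow> {t, x} \<in> E" for x
        using transfer[of s x t] transfer[of t x s] * st by (auto simp: insert_commute)
      then show False using * by (auto simp: col_def)
    qed
  qed
  have edges: "edge_exponents E = {x. Poly_Mapping.lookup x \<in> edge_vectors}"
  proof (intro equalityI subsetI)
    have ev: "Poly_Mapping.lookup (Poly_Mapping.single s 1 + Poly_Mapping.single t 1) = edge_vector s t" for s t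
      by (auto simp: fun_eq_iff lookup_add lookup_single when_def edge_vector_def)
    show "x \<in> {x. Poly_Mapping.lookup x \<in> edge_vectors}" if "x \<in> edge_exponents E" for x
      using that ev adj unfolding edge_exponents_def edge_vectors_def by blast
    fix x assume "x \<in> {x. Poly_Mapping.lookup x \<in> edge_vectors}"
    then obtain s t where "s \<in> V" "t \<in> V" "col s \<noteq> col t" "Poly_Mapping.lookup x = edge_vector s t"
      by (auto simp: edge_vectors_def)
    then have "{s, t} \<in> E" "x = Poly_Mapping.single s 1 + Poly_Mapping.single t 1"
      using adj ev[of s t] by (auto intro: poly_mapping_eqI)
    then show "x \<in> edge_exponents E" unfolding edge_exponents_def by blast
  qed
  have I: "I = ideal.span (monomial ` {x. Poly_Mapping.lookup x \<in> edge_vectors})"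
    unfolding I_def edge_ideal_eq edges ..
  have pow: "ideal_pow I m = ideal.span (monomial ` {x. Poly_Mapping.lookup x \<in> power_gens m})" for m
  proof (induction m)
    case 0
    have "{x. Poly_Mapping.lookup x \<in> power_gens 0} = {0}"
      unfolding power_gens_0 by (auto intro: poly_mapping_eqI)
    then show ?case by (simp only: ideal_pow.simps span_monomial_zero)
  next
    case (Suc m)
    have "ideal_pow I (Suc m) = ideal.span (monomial ` {a + b | a b.
        a \<in> {x. Poly_Mapping.lookup x \<in> edge_vectors} \<and> b \<in> {x. Poly_Mapping.lookup x \<in> power_gens m}})"
      unfolding ideal_pow.simps Suc.IH unfolding I ideal_prod_span_monomials ..
    then show ?case unfolding mem_Collect_eq sumset_lookup power_gens_Suc .
  qed
  show ?thesis
  proof (cases "\<exists>F :: ('n, 'k) free_complex. resolves_residue_field F")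
    \<comment> \<open>Both sides vanish in this case, so the Koszul complex need not be shown to be a resolution.\<close>
    case False
    then have "HS i J = {0}" for J :: "('n, 'k) polyring set"
      by (simp add: HS_def Tor_nonzero_def)
    moreover have "{f * g | f g. f \<in> I \<and> g \<in> {0}} \<subseteq> {0}" by auto
    then have "ideal_prod I {0} \<subseteq> {0}"
      unfolding ideal_prod_def by (rule ideal.span_minimal) (simp add: ideal.subspace_def)
    then have "ideal_prod I {0} = {0}"
      using ideal.span_zero unfolding ideal_prod_def by blast
    ultimately show ?thesis by simp
  next
    case True
    have HS: "HS i (ideal_pow I m) = ideal.span (monomial ` {x. Poly_Mapping.lookup x \<in> shift_gens m i})"
      if "1 \<le> m" for m
      unfolding HS_def pow Tor_nonzero_power[OF that] using True by (simp add: setcompr_eq_image)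
    have "HS i (ideal_pow I (k + 1)) = ideal.span (monomial ` {x. Poly_Mapping.lookup x \<in> shift_gens (Suc k) i})"
      using HS[of "Suc k"] by simp
    also have "\<dots> = ideal.span (monomial ` {a + b | a b.
        a \<in> {x. Poly_Mapping.lookup x \<in> edge_vectors} \<and> b \<in> {x. Poly_Mapping.lookup x \<in> shift_gens k i}})"
      unfolding mem_Collect_eq sumset_lookup shift_gens_Suc[OF \<open>1 \<le> i\<close> \<open>i \<le> k\<close>] ..
    also have "\<dots> = ideal_prod I (HS i (ideal_pow I k))"
      using HS[of k] \<open>1 \<le> i\<close> \<open>i \<le> k\<close> by (simp add: I ideal_prod_span_monomials)
    finally show ?thesis .
  qed
qed

end
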